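(* Consider the two-cell MIMO reverse-TDD cellular network described in the context, with channel entries drawn i.i.d. from a continuous distribution. Let $d_\alpha,d_\beta$ be positive integers and consider the symmetric tuple $d_{\alpha k}=d_\alpha$ for all $k\in[1:K]$, $d_{\beta l}=d_\beta$ for all $l\in[1:L]$. If \begin{align*} &Kd_\alpha\le M_\alpha,\qquad Ld_\beta\le M_\beta,\qquad Kd_\alpha+Ld_\beta\le\max(M_\alpha,M_\beta),\\ &\mathrm{mod}(N_{\alpha k}-d_\alpha,d_\beta)=\mathrm{mod}(N_{\beta l}-d_\beta,d_\alpha)=0\quad\text{for all }k\in[1:K],\ l\in[1:L],\\ &|\mathcal I_\alpha|\,|\mathcal I_\beta|\,d_\alpha d_\beta\le\sum_{k\in\mathcal I_\alpha}d_\alpha(N_{\alpha k}-d_\alpha)+\sum_{l\in\mathcal I_\beta}d_\beta(N_{\beta l}-d_\beta)\quad\text{for all }\mathcal I_\alpha\subseteq[1:K],\ \mathcal I_\beta\subseteq[1:L], \end{align*} then this symmetric tuple is feasible almost surely.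
   Context: Network model: Cell $\alpha$ operates in downlink: BS $\alpha$ with $M_\alpha$ antennas transmits to users $(\alpha,k)$, $k\in[1:K]$, user $(\alpha,k)$ having $N_{\alpha k}$ antennas. Cell $\beta$ operates in uplink: users $(\beta,l)$, $l\in[1:L]$, with $N_{\beta l}$ antennas transmit to BS $\beta$ with $M_\beta$ antennas. Received signals: $\mathbf y_{\alpha k}=\mathbf H_{\alpha k}\mathbf x_\alpha+\sum_{l=1}^L\mathbf G_{\alpha kl}\mathbf x_{\beta l}+\mathbf z_{\alpha k}$ and $\mathbf y_\beta=\sum_{l=1}^L\mathbf H_{\beta l}\mathbf x_{\beta l}+\mathbf G_\beta\mathbf x_\alpha+\mathbf z_\beta$, where $\mathbf H_{\alpha k}\in\mathbb C^{N_{\alpha k}\times M_\alpha}$, $\mathbf G_{\alpha kl}\in\mathbb C^{N_{\alpha k}\times N_{\beta l}}$, $\mathbf H_{\beta l}\in\mathbb C^{M_\beta\times N_{\beta l}}$, $\mathbf G_\beta\in\mathbb C^{M_\beta\times M_\alpha}$, all entries i.i.d. from a continuous distribution. Feasibility: a tuple $(d_{\alpha 1},\dots,d_{\alpha K},d_{\beta 1},\dots,d_{\beta L})$ of positive integers is feasible if there exist $\mathbf V_{\alpha k}\in\mathbb C^{M_\alpha\times d_{\alpha k}}$, $\mathbf U_{\alpha k}\in\mathbb C^{N_{\alpha k}\times d_{\alpha k}}$, $\mathbf V_{\beta l}\in\mathbb C^{N_{\beta l}\times d_{\beta l}}$, $\mathbf U_{\beta l}\in\mathbb C^{M_\beta\times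 d_{\beta l}}$ with $\mathbf U_{\alpha k}^\dagger\mathbf G_{\alpha kl}\mathbf V_{\beta l}=\mathbf 0$ ($\forall k,l$), $\mathbf U_{\beta l}^\dagger\mathbf G_\beta\mathbf V_{\alpha k}=\mathbf 0$ ($\forall k,l$), $\mathbf U_{\alpha k}^\dagger\mathbf H_{\alpha k}\mathbf V_{\alpha i}=\mathbf 0$ ($\forall i\ne k$), $\mathbf U_{\beta l}^\dagger\mathbf H_{\beta j}\mathbf V_{\beta j}=\mathbf 0$ ($\forall j\ne l$), $\mathrm{rank}(\mathbf U_{\alpha k}^\dagger\mathbf H_{\alpha k}\mathbf V_{\alpha k})=d_{\alpha k}$, $\mathrm{rank}(\mathbf U_{\beta l}^\dagger\mathbf H_{\beta l}\mathbf V_{\beta l})=d_{\beta l}$ ($\dagger$ = conjugate transpose). $\mathrm{mod}(n,m)$ denotes the remainder of $n$ divided by $m$. *)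

theory Defs
  imports "HOL-Analysis.Finite_Product_Measure" "HOL-Analysis.Radon_Nikodym" "HOL-Analysis.Lebesgue_Measure" "HOL-Probability.Probability_Measure"
    "Jordan_Normal_Form.DL_Rank" "Jordan_Normal_Form.Schur_Decomposition"
begin

text \<open>Positions of the random channel coefficients.
  HA k i j : entry (i,j) of H_{alpha k}  (N_{alpha k} x M_alpha)
  GA k l i j : entry (i,j) of G_{alpha k l}  (N_{alpha k} x N_{beta l})
  HB l i j : entry (i,j) of H_{beta l}  (M_beta x N_{beta l})
  GB i j : entry (i,j) of G_beta  (M_beta x M_alpha).
  User indices k, l range over 1..K and 1..L; matrix indices are 0-based.\<close>

datatype chan_key = HA nat nat nat | GA nat nat nat nat | HB nat nat nat | GB nat nat

definition chan_index ::
  "nat \<Rightarrow> nat \<Rightarrow> nat \<Rightarrow> nat \<Rightarrow> (nat \<Rightarrow> nat) \<Rightarrow> (nat \<Rightarrow> nat) \<Rightarrow> chan_key set" where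
  "chan_index K L Ma Mb Na Nb =
     {HA k i j | k i j. k \<in> {1..K} \<and> i < Na k \<and> j < Ma}
   \<union> {GA k l i j | k l i j. k \<in> {1..K} \<and> l \<in> {1..L} \<and> i < Na k \<and> j < Nb l}
   \<union> {HB l i j | l i j. l \<in> {1..L} \<and> i < Mb \<and> j < Nb l}
   \<union> {GB i j | i j. i < Mb \<and> j < Ma}"

definition crank :: "complex mat \<Rightarrow> nat" where
  "crank A = vec_space.rank (dim_row A) A"

definition feasible ::
  "nat \<Rightarrow> nat \<Rightarrow> nat \<Rightarrow> nat \<Rightarrow> (nat \<Rightarrow> nat) \<Rightarrow> (nat \<Rightarrow> nat)
   \<Rightarrow> (nat \<Rightarrow> nat) \<Rightarrow> (nat \<Rightarrow> nat) \<Rightarrow> (chan_key \<Rightarrow> complex) \<Rightarrow> bool" where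
  "feasible K L Ma Mb Na Nb da db h \<longleftrightarrow>
   (let Ha = (\<lambda>k. mat (Na k) Ma (\<lambda>(i,j). h (HA k i j)));
        Ga = (\<lambda>k l. mat (Na k) (Nb l) (\<lambda>(i,j). h (GA k l i j)));
        Hb = (\<lambda>l. mat Mb (Nb l) (\<lambda>(i,j). h (HB l i j)));
        Gb = mat Mb Ma (\<lambda>(i,j). h (GB i j))
    in \<exists>Va Ua Vb Ub.
       (\<forall>k\<in>{1..K}. Va k \<in> carrier_mat Ma (da k) \<and> Ua k \<in> carrier_mat (Na k) (da k)) \<and>
       (\<forall>l\<in>{1..L}. Vb l \<in> carrier_mat (Nb l) (db l) \<and> Ub l \<in> carrier_mat Mb (db l)) \<and>
       (\<forall>k\<in>{1..K}. \<forall>l\<in>{1..L}. mat_adjoint (Ua k) * Ga k l * Vb l = 0\<^sub>m (da k) (db l)) \<and>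
       (\<forall>k\<in>{1..K}. \<forall>l\<in>{1..L}. mat_adjoint (Ub l) * Gb * Va k = 0\<^sub>m (db l) (da k)) \<and>
       (\<forall>k\<in>{1..K}. \<forall>i\<in>{1..K}. i \<noteq> k \<longrightarrow> mat_adjoint (Ua k) * Ha k * Va i = 0\<^sub>m (da k) (da i)) \<and>
       (\<forall>l\<in>{1..L}. \<forall>j\<in>{1..L}. j \<noteq> l \<longrightarrow> mat_adjoint (Ub l) * Hb j * Vb j = 0\<^sub>m (db l) (db j)) \<and>
       (\<forall>k\<in>{1..K}. crank (mat_adjoint (Ua k) * Ha k * Va k) = da k) \<and>
       (\<forall>l\<in>{1..L}. crank (mat_adjoint (Ub l) * Hb l * Vb l) = db l))"

definition continuous_distr :: "complex measure \<Rightarrow> bool" where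
  "continuous_distr \<mu> \<longleftrightarrow> prob_space \<mu> \<and> sets \<mu> = sets borel \<and> absolutely_continuous lborel \<mu>"

end

theory Submission
  imports Defs
begin

text \<open>Given receivers \<open>U\<^sub>k\<close> of the downlink users and precoders \<open>V\<^sub>l\<close> of the uplink users with
  \<open>U\<^sub>k\<^sup>\<dagger> G\<^sub>k\<^sub>l V\<^sub>l = 0\<close>, the base stations only have to zero-force, which is possible as soon as two square
  matrices are nonsingular. Normalising \<open>U\<^sub>k\<^sup>\<dagger> = [I, X\<^sub>k]\<close> and \<open>V\<^sub>l = [I; Y\<^sub>l]\<close>, the alignment equations
  determine the top left blocks of the \<open>G\<^sub>k\<^sub>l\<close> as polynomials in \<open>X\<close>, \<open>Y\<close> and the other channel
  coefficients. The divisibility conditions split \<open>X\<^sub>k\<close> and \<open>Y\<^sub>l\<close> into blocks, and by Hall's theorem the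
  dimension count allows one to reserve a private block for each pair \<open>(k, l)\<close>. With the unreserved
  blocks set to zero, the channel becomes a polynomial map \<open>f\<close> of equally many variables whose linear
  part at a suitable point is invertible, so the components of \<open>f\<close> are algebraically independent.

  It remains to see that a generic point is of the form \<open>f \<xi>\<close> with \<open>\<rho> \<xi> \<noteq> 0\<close>, where \<open>\<rho>\<close> is the product of
  the two determinants. A point is a homomorphism from the subring generated by the components of \<open>f\<close>
  to the complex numbers; adjoining the missing variables one at a time, it extends to the whole
  polynomial ring with \<open>\<rho>\<close> not mapped to 0, unless a certain nonzero polynomial vanishes at the point.
  The zero set of that polynomial is a null set.\<close>

hide_const (open) module.smult

section \<open>Polynomials in arbitrarily many variables\<close>

text \<open>Polynomials are represented by the functions they define. Over the infinite field of
  complex numbers this loses nothing, and the type of variables may be infinite.\<close>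

inductive polyfun :: "(('v \<Rightarrow> complex) \<Rightarrow> complex) \<Rightarrow> bool" where
  const: "polyfun (\<lambda>_. c)"
| var: "polyfun (\<lambda>h. h v)"
| add: "polyfun p \<Longrightarrow> polyfun q \<Longrightarrow> polyfun (\<lambda>h. p h + q h)"
| mult: "polyfun p \<Longrightarrow> polyfun q \<Longrightarrow> polyfun (\<lambda>h. p h * q h)"

text \<open>Curves with polynomial coordinates reduce questions in many variables to one variable,
  where nonzero polynomials have finitely many roots.\<close>

lemma polyfun_along_curve:
  assumes "polyfun p" "\<And>v. \<exists>r. \<forall>s. u s v = poly r s"
  shows "\<exists>r. \<forall>s. p (u s) = poly r s"
  using assms(1)
proof induction
  case (const c)
  then show ?case by (intro exI[of _ "[:c:]"]) auto
next
  case (var v)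
  then show ?case using assms(2) by blast
next
  case (add p q)
  then show ?case by (metis poly_add)
next
  case (mult p q)
  then show ?case by (metis poly_mult)
qed

text \<open>On the line through \<open>a\<close> and \<open>b\<close> both functions become nonzero
  univariate polynomials, whose product is again nonzero.\<close>

lemma polyfun_no_zero_divisors:
  assumes "polyfun p" "polyfun q" "p a \<noteq> 0" "q b \<noteq> 0"
  shows "\<exists>c. p c * q c \<noteq> 0"
proof -
  define u where "u s v = a v + s * (b v - a v)" for s v
  have u: "\<exists>r. \<forall>s. u s v = poly r s" for v
    by (rule exI[of _ "[:a v, b v - a v:]"]) (simp add: u_def)
  obtain r1 where r1: "\<forall>s. p (u s) = poly r1 s" using polyfun_along_curve[OF assms(1)] u by metis
  obtain r2 where r2: "\<forall>s. q (u s) = poly r2 s" using polyfun_along_curve[OF assms(2)] u by metis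
  have "poly r1 0 \<noteq> 0" "poly r2 1 \<noteq> 0"
    using assms(3,4) spec[OF r1, of 0] spec[OF r2, of 1] by (simp_all add: u_def[abs_def])
  then have "r1 * r2 \<noteq> 0" by auto
  then obtain s where "poly (r1 * r2) s \<noteq> 0" using poly_all_0_iff_0 by blast
  then have "p (u s) * q (u s) \<noteq> 0" using r1 r2 by auto
  then show ?thesis by blast
qed

section \<open>The integral domain of polynomial functions\<close>

typedef 'v mpoly = "{p :: ('v \<Rightarrow> complex) \<Rightarrow> complex. polyfun p}"
  morphisms peval Abs_mpoly
  by (auto intro: polyfun.const)

setup_lifting type_definition_mpoly

instantiation mpoly :: (type) idom
begin

lift_definition zero_mpoly :: "'a mpoly" is "\<lambda>_. 0" by (rule polyfun.const)
lift_definition one_mpoly :: "'a mpoly" is "\<lambda>_. 1" by (rule polyfun.const)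
lift_definition plus_mpoly :: "'a mpoly \<Rightarrow> 'a mpoly \<Rightarrow> 'a mpoly" is "\<lambda>p q h. p h + q h"
  by (rule polyfun.add)
lift_definition times_mpoly :: "'a mpoly \<Rightarrow> 'a mpoly \<Rightarrow> 'a mpoly" is "\<lambda>p q h. p h * q h"
  by (rule polyfun.mult)
lift_definition uminus_mpoly :: "'a mpoly \<Rightarrow> 'a mpoly" is "\<lambda>p h. - p h"
  using polyfun.mult[OF polyfun.const[of "- 1"]] by simp
lift_definition minus_mpoly :: "'a mpoly \<Rightarrow> 'a mpoly \<Rightarrow> 'a mpoly" is "\<lambda>p q h. p h - q h"
  using polyfun.add[OF _ polyfun.mult[OF polyfun.const[of "- 1"]]] by simp

instance
proof
  fix a b :: "'a mpoly"
  show "a \<noteq> 0 \<Longrightarrow> b \<noteq> 0 \<Longrightarrow> a * b \<noteq> 0"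
    by transfer (metis polyfun_no_zero_divisors)
  show "(0::'a mpoly) \<noteq> 1" by transfer (metis zero_neq_one)
qed (transfer; simp add: algebra_simps fun_eq_iff)+

end

lift_definition Const :: "complex \<Rightarrow> 'v mpoly" is "\<lambda>c _. c" by (rule polyfun.const)
lift_definition Var :: "'v \<Rightarrow> 'v mpoly" is "\<lambda>v h. h v" by (rule polyfun.var)

lemma peval_simps [simp]:
  "peval 0 h = 0" "peval 1 h = 1" "peval (p + q) h = peval p h + peval q h"
  "peval (p * q) h = peval p h * peval q h" "peval (- p) h = - peval p h"
  "peval (p - q) h = peval p h - peval q h" "peval (Const c) h = c" "peval (Var v) h = h v"
  by (transfer; simp)+

lemma peval_sum [simp]: "peval (\<Sum>i\<in>A. p i) h = (\<Sum>i\<in>A. peval (p i) h)"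
  by (induction A rule: infinite_finite_induct) auto

lemma mpoly_eq_iff: "p = q \<longleftrightarrow> (\<forall>h. peval p h = peval q h)"
  by transfer auto

lemma mpoly_induct [case_names Const Var add mult, induct type]:
  assumes "\<And>c. P (Const c)" "\<And>v. P (Var v)"
    "\<And>p q. P p \<Longrightarrow> P q \<Longrightarrow> P (p + q)" "\<And>p q. P p \<Longrightarrow> P q \<Longrightarrow> P (p * q)"
  shows "P (p :: 'a mpoly)"
proof -
  have "\<forall>q. peval q = f \<longrightarrow> P q" if "polyfun f" for f :: "('a \<Rightarrow> complex) \<Rightarrow> complex"
    using that
  proof induction
    case (const c)
    have "q = Const c" if "peval q = (\<lambda>_. c)" for q :: "'a mpoly" using that by (simp add: mpoly_eq_iff)
    then show ?case using assms(1) by blast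
  next
    case (var v)
    have "q = Var v" if "peval q = (\<lambda>h. h v)" for q :: "'a mpoly" using that by (simp add: mpoly_eq_iff)
    then show ?case using assms(2) by blast
  next
    case (add f g)
    then have e: "peval (Abs_mpoly f) = f" "peval (Abs_mpoly g) = g" by (auto simp: Abs_mpoly_inverse)
    have "q = Abs_mpoly f + Abs_mpoly g" if "peval q = (\<lambda>h. f h + g h)" for q
      using that e by (simp add: mpoly_eq_iff)
    then show ?case using assms(3) add.IH e by blast
  next
    case (mult f g)
    then have e: "peval (Abs_mpoly f) = f" "peval (Abs_mpoly g) = g" by (auto simp: Abs_mpoly_inverse)
    have "q = Abs_mpoly f * Abs_mpoly g" if "peval q = (\<lambda>h. f h * g h)" for q
      using that e by (simp add: mpoly_eq_iff)
    then show ?case using assms(4) mult.IH e by blast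
  qed
  then show ?thesis using peval by blast
qed

section \<open>Extending homomorphisms into the complex numbers\<close>

text \<open>Subrings are sets rather than types, so polynomials over \<open>A\<close> are
  polynomials over the ambient domain with constrained coefficients.\<close>

definition coeffs_in :: "'r::idom set \<Rightarrow> 'r poly \<Rightarrow> bool" where
  "coeffs_in A q \<longleftrightarrow> (\<forall>i. coeff q i \<in> A)"

definition is_subring :: "'r::idom set \<Rightarrow> bool" where
  "is_subring A \<longleftrightarrow> 1 \<in> A \<and> (\<forall>a\<in>A. \<forall>b\<in>A. a - b \<in> A \<and> a * b \<in> A)"

definition is_hom :: "'r::idom set \<Rightarrow> ('r \<Rightarrow> complex) \<Rightarrow> bool" where
  "is_hom A \<phi> \<longleftrightarrow> \<phi> 1 = 1 \<and> (\<forall>a\<in>A. \<forall>b\<in>A. \<phi> (a + b) = \<phi> a + \<phi> b \<and> \<phi> (a * b) = \<phi> a * \<phi> b)"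

definition adjoin :: "'r::idom set \<Rightarrow> 'r \<Rightarrow> 'r set" where
  "adjoin A x = {poly q x | q. coeffs_in A q}"

section \<open>Subrings, adjoined elements and homomorphisms\<close>

lemma is_subringD:
  assumes "is_subring A"
  shows "0 \<in> A" "1 \<in> A" "a \<in> A \<Longrightarrow> b \<in> A \<Longrightarrow> a + b \<in> A" "a \<in> A \<Longrightarrow> b \<in> A \<Longrightarrow> a * b \<in> A"
    "a \<in> A \<Longrightarrow> b \<in> A \<Longrightarrow> a - b \<in> A" "a \<in> A \<Longrightarrow> a ^ n \<in> A"
proof -
  show 1: "1 \<in> A" and m: "\<And>a b. a \<in> A \<Longrightarrow> b \<in> A \<Longrightarrow> a * b \<in> A"
    and s: "\<And>a b. a \<in> A \<Longrightarrow> b \<in> A \<Longrightarrow> a - b \<in> A"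
    using assms by (auto simp: is_subring_def)
  show 0: "0 \<in> A" using s[OF 1 1] by simp
  show "a \<in> A \<Longrightarrow> b \<in> A \<Longrightarrow> a + b \<in> A" using s[of a "0 - b"] s[OF 0, of b] by simp
  show "a \<in> A \<Longrightarrow> a ^ n \<in> A" by (induction n) (auto intro: 1 m)
qed

lemma is_subring_sum:
  assumes "is_subring A" "\<And>i. i \<in> I \<Longrightarrow> f i \<in> A"
  shows "sum f I \<in> A"
  using assms(2) by (induction I rule: infinite_finite_induct) (auto intro: is_subringD[OF assms(1)])

lemma coeffs_in_intros:
  assumes "is_subring A"
  shows "coeffs_in A 0" "coeffs_in A 1"
    "coeffs_in A p \<Longrightarrow> coeffs_in A q \<Longrightarrow> coeffs_in A (p + q)"
    "coeffs_in A p \<Longrightarrow> coeffs_in A q \<Longrightarrow> coeffs_in A (p - q)"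
    "coeffs_in A p \<Longrightarrow> coeffs_in A q \<Longrightarrow> coeffs_in A (p * q)"
    "a \<in> A \<Longrightarrow> coeffs_in A p \<Longrightarrow> coeffs_in A (smult a p)"
    "a \<in> A \<Longrightarrow> coeffs_in A (monom a n)"
    "a \<in> A \<Longrightarrow> coeffs_in A [:a:]"
    "a \<in> A \<Longrightarrow> coeffs_in A p \<Longrightarrow> coeffs_in A (pCons a p)"
  using assms
  by (auto simp: coeffs_in_def coeff_mult coeff_pCons coeff_1 intro!: is_subringD is_subring_sum split: nat.split)

lemma is_subring_adjoin:
  assumes "is_subring A"
  shows "is_subring (adjoin A x)" "A \<subseteq> adjoin A x" "x \<in> adjoin A x"
proof -
  note c = coeffs_in_intros[OF assms]
  have "1 \<in> adjoin A x"
    unfolding adjoin_def by (auto intro!: exI[of _ 1] c)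
  moreover have "a - b \<in> adjoin A x \<and> a * b \<in> adjoin A x" if "a \<in> adjoin A x" "b \<in> adjoin A x" for a b
    using that unfolding adjoin_def by (auto simp flip: poly_diff poly_mult intro: c)
  ultimately show "is_subring (adjoin A x)" by (auto simp: is_subring_def)
  show "A \<subseteq> adjoin A x"
    unfolding adjoin_def by (force intro: c)
  have "coeffs_in A [:0, 1:]" by (intro c is_subringD(1,2)[OF assms])
  then show "x \<in> adjoin A x" unfolding adjoin_def by force
qed

lemma is_homD:
  assumes "is_hom A \<phi>" "is_subring A"
  shows "\<phi> 0 = 0" "\<phi> 1 = 1" "a \<in> A \<Longrightarrow> b \<in> A \<Longrightarrow> \<phi> (a + b) = \<phi> a + \<phi> b"
    "a \<in> A \<Longrightarrow> b \<in> A \<Longrightarrow> \<phi> (a * b) = \<phi> a * \<phi> b"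
    "a \<in> A \<Longrightarrow> b \<in> A \<Longrightarrow> \<phi> (a - b) = \<phi> a - \<phi> b"
proof -
  show one: "\<phi> 1 = 1" and a: "\<And>a b. a \<in> A \<Longrightarrow> b \<in> A \<Longrightarrow> \<phi> (a + b) = \<phi> a + \<phi> b"
    and "a \<in> A \<Longrightarrow> b \<in> A \<Longrightarrow> \<phi> (a * b) = \<phi> a * \<phi> b"
    using assms(1) by (auto simp: is_hom_def)
  show "\<phi> 0 = 0" using a[of 0 0] is_subringD(1)[OF assms(2)] by simp
  show "a \<in> A \<Longrightarrow> b \<in> A \<Longrightarrow> \<phi> (a - b) = \<phi> a - \<phi> b"
    using a[of "a - b" b] is_subringD(5)[OF assms(2)] by (simp add: algebra_simps)
qed

lemma is_hom_sum:
  assumes "is_hom A \<phi>" "is_subring A" "\<And>i. i \<in> I \<Longrightarrow> f i \<in> A"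
  shows "\<phi> (sum f I) = (\<Sum>i\<in>I. \<phi> (f i))"
  using assms(3)
  by (induction I rule: infinite_finite_induct)
    (auto simp: is_homD[OF assms(1,2)] is_subring_sum[OF assms(2)])

lemma map_poly_hom:
  assumes "is_hom A \<phi>" "is_subring A" "coeffs_in A p" "coeffs_in A q"
  shows "map_poly \<phi> (p + q) = map_poly \<phi> p + map_poly \<phi> q"
    "map_poly \<phi> (p - q) = map_poly \<phi> p - map_poly \<phi> q"
    "map_poly \<phi> (p * q) = map_poly \<phi> p * map_poly \<phi> q"
  using assms
  by (auto intro!: poly_eqI sum.cong simp: coeff_map_poly is_homD[OF assms(1,2)] coeff_mult coeffs_in_def
      is_hom_sum[OF assms(1,2)] is_subringD)

text \<open>Long division without inverses: the dividend is multiplied by the leading coefficient of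
  \<open>p\<close> before each subtraction, which accounts for the power \<open>n\<close>.\<close>

lemma pseudo_division_in:
  assumes A: "is_subring A" and p: "coeffs_in A p" "p \<noteq> 0" and q: "coeffs_in A q"
  shows "\<exists>n c r. coeffs_in A c \<and> coeffs_in A r \<and> smult (lead_coeff p ^ n) q = p * c + r \<and>
     (r = 0 \<or> degree r < degree p)"
  using q
proof (induction "degree q" arbitrary: q rule: less_induct)
  case less
  note c = coeffs_in_intros[OF A]
  let ?a = "lead_coeff p"
  have a: "?a \<in> A" using p by (auto simp: coeffs_in_def)
  show ?case
  proof (cases "q = 0 \<or> degree q < degree p")
    case True
    then show ?thesis using less c(1) by (intro exI[of _ 0] exI[of _ q]) auto
  next
    case False
    define e where "e = degree q - degree p"
    define m where "m = monom (lead_coeff q) e"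
    have mA: "coeffs_in A m" unfolding m_def using less.prems by (intro c) (auto simp: coeffs_in_def)
    define q' where "q' = smult ?a q - p * m"
    have q'A: "coeffs_in A q'" unfolding q'_def using mA p less.prems a by (intro c)
    have dm: "degree (p * m) = degree q"
      using False p unfolding m_def e_def by (auto simp: degree_mult_eq degree_monom_eq)
    then have dm2: "coeff (p * m) (degree q) = ?a * lead_coeff q"
      using lead_coeff_mult[of p m] lead_coeff_monom[of "lead_coeff q" e] by (simp flip: m_def)
    have q'0: "coeff q' (degree q) = 0" using dm2 unfolding q'_def by simp
    have le: "degree q' \<le> degree q"
      unfolding q'_def using dm degree_diff_le degree_smult_le by (metis order_refl)
    \<comment> \<open>A constant dividend has no degree to lose, hence the separate case of a
      vanishing \<open>q'\<close>.\<close>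
    consider "q' = 0" | "degree q' < degree q"
      using q'0 le by (metis leading_coeff_0_iff le_neq_implies_less)
    then show ?thesis
    proof cases
      case 1
      then show ?thesis using mA c(1) unfolding q'_def
        by (intro exI[of _ 1] exI[of _ m] exI[of _ 0]) auto
    next
      case 2
      from less.hyps[OF this q'A] obtain n c' r where h: "coeffs_in A c'" "coeffs_in A r"
        "smult (?a ^ n) q' = p * c' + r" "r = 0 \<or> degree r < degree p" by auto
      have "smult (?a ^ Suc n) q = smult (?a ^ n) q' + smult (?a ^ n) (p * m)"
        unfolding q'_def by (simp add: smult_diff_right mult.commute)
      also have "\<dots> = p * (c' + smult (?a ^ n) m) + r" using h by (simp add: algebra_simps)
      finally show ?thesis using h mA a
        by (intro exI[of _ "Suc n"] exI[of _ "c' + smult (?a ^ n) m"] exI[of _ r])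
          (auto intro!: c is_subringD[OF A])
    qed
  qed
qed

lemma map_poly_const_hom:
  assumes "is_hom A \<phi>" "is_subring A"
  shows "map_poly \<phi> [:a:] = [:\<phi> a:]"
  by (rule poly_eqI) (simp add: coeff_map_poly is_homD[OF assms] coeff_pCons split: nat.split)

text \<open>Sending \<open>x\<close> to \<open>\<tau>\<close> is well defined because every relation
  of \<open>x\<close> over \<open>A\<close> is mapped to a relation of
  \<open>\<tau>\<close>.\<close>

lemma hom_adjoin_of_root:
  assumes A: "is_subring A" and \<phi>: "is_hom A \<phi>"
    and \<tau>: "\<And>q. coeffs_in A q \<Longrightarrow> poly q x = 0 \<Longrightarrow> poly (map_poly \<phi> q) \<tau> = 0"
  obtains \<phi>' where "is_hom (adjoin A x) \<phi>'" "\<And>a. a \<in> A \<Longrightarrow> \<phi>' a = \<phi> a"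
    "\<And>q. coeffs_in A q \<Longrightarrow> \<phi>' (poly q x) = poly (map_poly \<phi> q) \<tau>"
proof -
  note c = coeffs_in_intros[OF A] and h = map_poly_hom[OF \<phi> A]
  define \<phi>' where "\<phi>' z = poly (map_poly \<phi> (SOME q. coeffs_in A q \<and> poly q x = z)) \<tau>" for z
  have ev: "\<phi>' (poly q x) = poly (map_poly \<phi> q) \<tau>" if q: "coeffs_in A q" for q
  proof -
    define q' where "q' = (SOME q'. coeffs_in A q' \<and> poly q' x = poly q x)"
    have q': "coeffs_in A q' \<and> poly q' x = poly q x"
      unfolding q'_def by (rule someI[of _ q]) (use q in simp)
    \<comment> \<open>The chosen representative and \<open>q\<close> differ by a relation of
      \<open>x\<close>.\<close>
    then have "poly (map_poly \<phi> (q' - q)) \<tau> = 0" using q by (intro \<tau> c) auto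
    then show ?thesis using q q' by (simp add: \<phi>'_def h flip: q'_def)
  qed
  have ext: "\<phi>' a = \<phi> a" if "a \<in> A" for a
    using ev[of "[:a:]"] that c(8) by (simp add: map_poly_const_hom[OF \<phi> A])
  have "is_hom (adjoin A x) \<phi>'"
    unfolding is_hom_def adjoin_def
    using ext[of 1] is_subringD(2)[OF A] is_homD(2)[OF \<phi> A]
    by (auto simp: ev h c simp flip: poly_add poly_mult)
  then show thesis using that ext ev by blast
qed

text \<open>A relation of least degree acts as a minimal polynomial over the fraction field, so a
  nonzero element of A[x] has an inverse there; clearing denominators leaves the scalar
  \<open>v\<close>. The induction is the Euclidean algorithm with pseudo-division.\<close>

lemma inverse_up_to_scalar_mod_minimal:
  assumes A: "is_subring A" and p: "coeffs_in A p" "p \<noteq> 0" "poly p x = 0"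
    and min: "\<And>q. coeffs_in A q \<Longrightarrow> q \<noteq> 0 \<Longrightarrow> poly q x = 0 \<Longrightarrow> degree p \<le> degree q"
    and q: "coeffs_in A q" "poly q x \<noteq> 0"
  shows "\<exists>s v. coeffs_in A s \<and> v \<in> A \<and> v \<noteq> 0 \<and> poly s x * poly q x = v"
  using q
proof (induction "degree q" arbitrary: q rule: less_induct)
  case less
  note c = coeffs_in_intros[OF A]
  consider "degree q = 0" | "degree p \<le> degree q" | "0 < degree q" "degree q < degree p" by linarith
  then show ?case
  proof cases
    case 1
    then obtain a where "q = [:a:]" using degree_eq_zeroE by blast
    moreover from this have "a \<in> A" using less.prems(1) unfolding coeffs_in_def by (metis coeff_pCons_0)
    ultimately show ?thesis using less.prems c(2) by (intro exI[of _ 1] exI[of _ a]) auto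
  next
    case 2
    obtain n b r where d: "coeffs_in A b" "coeffs_in A r" "smult (lead_coeff p ^ n) q = p * b + r"
      "r = 0 \<or> degree r < degree p" using pseudo_division_in[OF A p(1,2) less.prems(1)] by blast
    have r: "lead_coeff p ^ n * poly q x = poly r x"
      using arg_cong[OF d(3), of "\<lambda>f. poly f x"] p(3) by simp
    then have "poly r x \<noteq> 0" using p less.prems by auto
    then obtain s v where s: "coeffs_in A s" "v \<in> A" "v \<noteq> 0" "poly s x * poly r x = v"
      using less.hyps[of r] d 2 by fastforce
    then have "poly (smult (lead_coeff p ^ n) s) x * poly q x = v" by (simp flip: r add: algebra_simps)
    moreover have "coeffs_in A (smult (lead_coeff p ^ n) s)"
      using s p by (intro c is_subringD[OF A]) (auto simp: coeffs_in_def)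
    ultimately show ?thesis using s by blast
  next
    case 3
    then have q0: "q \<noteq> 0" by auto
    \<comment> \<open>Now \<open>p\<close> is divided by \<open>q\<close>. As \<open>p\<close>
      vanishes at \<open>x\<close>, the value of the remainder is a multiple of that of
      \<open>q\<close>, so a cofactor for the remainder yields one for \<open>q\<close>.\<close>
    obtain n b r where d: "coeffs_in A b" "coeffs_in A r" "smult (lead_coeff q ^ n) p = q * b + r"
      "r = 0 \<or> degree r < degree q" using pseudo_division_in[OF A less.prems(1) q0 p(1)] by blast
    have e: "poly r x = - poly b x * poly q x"
      using arg_cong[OF d(3), of "\<lambda>f. poly f x"] p(3) by (simp add: eq_neg_iff_add_eq_0 algebra_simps)
    show ?thesis
    proof (cases "poly r x = 0")
      \<comment> \<open>A remainder vanishing at \<open>x\<close> is zero, so \<open>p\<close>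
        splits up to a scalar as \<open>q * b\<close>; then \<open>b\<close> is a relation of
        smaller degree, against minimality.\<close>
      case True
      then have "r = 0" using min[OF d(2)] d(4) 3 by fastforce
      then have qb: "smult (lead_coeff q ^ n) p = q * b" using d by simp
      then have "b \<noteq> 0" using p q0 by auto
      then have "degree q + degree b = degree p"
        using arg_cong[OF qb, of degree] q0 by (simp add: degree_mult_eq)
      moreover have "poly b x = 0" using True e less.prems by simp
      ultimately show ?thesis using min[OF d(1) \<open>b \<noteq> 0\<close>] 3 by simp
    next
      case False
      then obtain s v where s: "coeffs_in A s" "v \<in> A" "v \<noteq> 0" "poly s x * poly r x = v"
        using less.hyps[of r] d by fastforce
      then have "poly (0 - s * b) x * poly q x = v" by (simp add: e algebra_simps)
      moreover have "coeffs_in A (0 - s * b)" using s d by (intro c)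
      ultimately show ?thesis using s by blast
    qed
  qed
qed

text \<open>This is the extension property behind the Nullstellensatz. The element \<open>v\<close>
  is fixed before \<open>\<phi>\<close>, so one nonvanishing condition serves all
  homomorphisms.\<close>

definition homs_extend :: "'r::idom set \<Rightarrow> 'r set \<Rightarrow> bool" where
  "homs_extend A B \<longleftrightarrow> (\<forall>w\<in>B - {0}. \<exists>v\<in>A - {0}. \<forall>\<phi>. is_hom A \<phi> \<longrightarrow> \<phi> v \<noteq> 0 \<longrightarrow>
     (\<exists>\<phi>'. is_hom B \<phi>' \<and> (\<forall>a\<in>A. \<phi>' a = \<phi> a) \<and> \<phi>' w \<noteq> 0))"

text \<open>If \<open>x\<close> is transcendental over \<open>A\<close>, it can be sent to any
  number that keeps the image of \<open>w\<close> nonzero; if it is algebraic, it is sent to a root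
  of the image of a relation of least degree.\<close>

lemma homs_extend_adjoin:
  assumes A: "is_subring A"
  shows "homs_extend A (adjoin A x)"
  unfolding homs_extend_def
proof
  fix w assume "w \<in> adjoin A x - {0}"
  then have w: "w \<in> adjoin A x" "w \<noteq> 0" by auto
  have "\<exists>v. v \<in> A \<and> v \<noteq> 0 \<and> (\<forall>\<phi>. is_hom A \<phi> \<longrightarrow> \<phi> v \<noteq> 0 \<longrightarrow>
     (\<exists>\<phi>'. is_hom (adjoin A x) \<phi>' \<and> (\<forall>a\<in>A. \<phi>' a = \<phi> a) \<and> \<phi>' w \<noteq> 0))" (is "\<exists>v. ?G v")
  proof -
    note c = coeffs_in_intros[OF A]
    obtain q where q: "coeffs_in A q" "w = poly q x" using w by (auto simp: adjoin_def)
    show ?thesis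
    proof (cases "\<forall>p. coeffs_in A p \<and> poly p x = 0 \<longrightarrow> p = 0")
      case True
      show ?thesis
      proof (rule exI, intro conjI allI impI)
        show "lead_coeff q \<in> A" "lead_coeff q \<noteq> 0" using q w by (auto simp: coeffs_in_def)
        fix \<phi> assume \<phi>: "is_hom A \<phi>" "\<phi> (lead_coeff q) \<noteq> 0"
        have "coeff (map_poly \<phi> q) (degree q) \<noteq> 0"
          using \<phi> by (simp add: coeff_map_poly is_homD[OF _ A])
        then have "map_poly \<phi> q \<noteq> 0" by auto
        then obtain \<tau> where "poly (map_poly \<phi> q) \<tau> \<noteq> 0" using poly_all_0_iff_0 by blast
        moreover obtain \<phi>' where "is_hom (adjoin A x) \<phi>'" "\<And>a. a \<in> A \<Longrightarrow> \<phi>' a = \<phi> a"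
          "\<And>q. coeffs_in A q \<Longrightarrow> \<phi>' (poly q x) = poly (map_poly \<phi> q) \<tau>"
          by (rule hom_adjoin_of_root[OF A \<phi>(1)]) (use True in auto)
        ultimately show "\<exists>\<phi>'. is_hom (adjoin A x) \<phi>' \<and> (\<forall>a\<in>A. \<phi>' a = \<phi> a) \<and> \<phi>' w \<noteq> 0"
          using q by auto
      qed
    next
      case False
      define Z where "Z = {p. coeffs_in A p \<and> p \<noteq> 0 \<and> poly p x = 0}"
      obtain p where "p \<in> Z" "\<And>q. q \<in> Z \<Longrightarrow> degree p \<le> degree q"
        using False arg_min_nat_lemma[of "\<lambda>p. p \<in> Z" _ degree] unfolding Z_def by blast
      then have p: "coeffs_in A p" "p \<noteq> 0" "poly p x = 0"
        and min: "\<And>q. coeffs_in A q \<Longrightarrow> q \<noteq> 0 \<Longrightarrow> poly q x = 0 \<Longrightarrow> degree p \<le> degree q"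
        by (auto simp: Z_def)
      let ?a = "lead_coeff p"
      have a: "?a \<in> A" "?a \<noteq> 0" using p by (auto simp: coeffs_in_def)
      have dp: "degree p > 0" using p by (metis degree_eq_zeroE gr0I pCons_eq_0_iff poly_const_conv)
      obtain s v where s: "coeffs_in A s" "v \<in> A" "v \<noteq> 0" "poly s x * w = v"
        using inverse_up_to_scalar_mod_minimal[OF A p min q(1)] w(2) unfolding q(2) by blast
      show ?thesis
      proof (rule exI, intro conjI allI impI)
        \<comment> \<open>The factor \<open>?a\<close> keeps the image of \<open>p\<close>
          nonconstant, so that it has a root; the factor \<open>v\<close> keeps the image of
          \<open>w\<close> nonzero because \<open>poly s x * w = v\<close>.\<close>
        show "?a * v \<in> A" "?a * v \<noteq> 0" using a s by (auto intro: is_subringD[OF A])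
        fix \<phi> assume \<phi>: "is_hom A \<phi>" "\<phi> (?a * v) \<noteq> 0"
        note h = map_poly_hom[OF \<phi>(1) A]
        have nz: "\<phi> ?a \<noteq> 0" "\<phi> v \<noteq> 0" using \<phi>(2) is_homD(4)[OF \<phi>(1) A a(1) s(2)] by auto
        have pw: "\<phi> (?a ^ n) = \<phi> ?a ^ n" for n
          by (induction n) (auto simp: is_homD[OF \<phi>(1) A] is_subringD[OF A] a)
        have "coeff (map_poly \<phi> p) (degree p) \<noteq> 0"
          using nz by (simp add: coeff_map_poly is_homD[OF \<phi>(1) A])
        then have "degree (map_poly \<phi> p) > 0" using dp le_degree order_less_le_trans by blast
        then obtain \<tau> where \<tau>: "poly (map_poly \<phi> p) \<tau> = 0"
          using fundamental_theorem_of_algebra[of "map_poly \<phi> p"] by (auto simp: constant_degree)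
        \<comment> \<open>Up to a power of \<open>?a\<close>, whose image is nonzero, every relation
          of \<open>x\<close> is a multiple of \<open>p\<close>.\<close>
        have "poly (map_poly \<phi> g) \<tau> = 0" if g: "coeffs_in A g" "poly g x = 0" for g
        proof -
          obtain n b r where d: "coeffs_in A b" "coeffs_in A r" "smult (?a ^ n) g = p * b + r"
            "r = 0 \<or> degree r < degree p" using pseudo_division_in[OF A p(1,2) g(1)] by blast
          have "poly r x = 0"
            using arg_cong[OF d(3), of "\<lambda>f. poly f x"] p(3) g by simp
          then have "r = 0" using min[OF d(2)] d(4) by fastforce
          then have "[:?a ^ n:] * g = p * b" using d by simp
          then have "map_poly \<phi> [:?a ^ n:] * map_poly \<phi> g = map_poly \<phi> p * map_poly \<phi> b"
            using g d p a by (simp only: h(3)[symmetric] c is_subringD[OF A])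
          then have "poly (map_poly \<phi> [:?a ^ n:]) \<tau> * poly (map_poly \<phi> g) \<tau> = 0"
            using \<tau> by (metis poly_mult mult_zero_left)
          then show ?thesis using nz by (simp add: map_poly_const_hom[OF \<phi>(1) A] pw)
        qed
        then obtain \<phi>' where \<phi>': "is_hom (adjoin A x) \<phi>'" "\<And>a. a \<in> A \<Longrightarrow> \<phi>' a = \<phi> a"
          using hom_adjoin_of_root[OF A \<phi>(1)] by metis
        have "poly s x \<in> adjoin A x" using s by (auto simp: adjoin_def)
        then have "\<phi>' (poly s x) * \<phi>' w = \<phi> v"
          using is_homD(4)[OF \<phi>'(1) is_subring_adjoin(1)[OF A], of "poly s x" w] w s \<phi>' by auto
        then have "\<phi>' w \<noteq> 0" using nz by auto
        then show "\<exists>\<phi>'. is_hom (adjoin A x) \<phi>' \<and> (\<forall>a\<in>A. \<phi>' a = \<phi> a) \<and> \<phi>' w \<noteq> 0"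
          using \<phi>' by blast
      qed
    qed
  qed
  then show "\<exists>v\<in>A - {0}. \<forall>\<phi>. is_hom A \<phi> \<longrightarrow> \<phi> v \<noteq> 0 \<longrightarrow>
     (\<exists>\<phi>'. is_hom (adjoin A x) \<phi>' \<and> (\<forall>a\<in>A. \<phi>' a = \<phi> a) \<and> \<phi>' w \<noteq> 0)" by blast
qed

lemma homs_extend_refl: "homs_extend A A"
  unfolding homs_extend_def by (metis DiffD1 DiffD2)

lemma homs_extend_trans:
  assumes "homs_extend A B" "homs_extend B C" "A \<subseteq> B"
  shows "homs_extend A C"
  unfolding homs_extend_def
proof
  fix w assume w: "w \<in> C - {0}"
  obtain u where u: "u \<in> B - {0}" and u': "\<forall>\<phi>. is_hom B \<phi> \<longrightarrow> \<phi> u \<noteq> 0 \<longrightarrow>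
     (\<exists>\<phi>'. is_hom C \<phi>' \<and> (\<forall>a\<in>B. \<phi>' a = \<phi> a) \<and> \<phi>' w \<noteq> 0)"
    by (rule bexE[OF bspec[OF assms(2)[unfolded homs_extend_def] w]])
  obtain v where v: "v \<in> A - {0}" and v': "\<forall>\<phi>. is_hom A \<phi> \<longrightarrow> \<phi> v \<noteq> 0 \<longrightarrow>
     (\<exists>\<phi>'. is_hom B \<phi>' \<and> (\<forall>a\<in>A. \<phi>' a = \<phi> a) \<and> \<phi>' u \<noteq> 0)"
    by (rule bexE[OF bspec[OF assms(1)[unfolded homs_extend_def] u]])
  have "\<exists>\<phi>'. is_hom C \<phi>' \<and> (\<forall>a\<in>A. \<phi>' a = \<phi> a) \<and> \<phi>' w \<noteq> 0" if h: "is_hom A \<phi>" "\<phi> v \<noteq> 0" for \<phi>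
  proof -
    obtain \<phi>1 where 1: "is_hom B \<phi>1" "\<forall>a\<in>A. \<phi>1 a = \<phi> a" "\<phi>1 u \<noteq> 0" using v' h by blast
    obtain \<phi>2 where 2: "is_hom C \<phi>2" "\<forall>a\<in>B. \<phi>2 a = \<phi>1 a" "\<phi>2 w \<noteq> 0" using u' 1(1,3) by blast
    have "\<forall>a\<in>A. \<phi>2 a = \<phi> a" using 1(2) 2(2) assms(3) by auto
    then show ?thesis using 2 by blast
  qed
  then show "\<exists>v\<in>A - {0}. \<forall>\<phi>. is_hom A \<phi> \<longrightarrow> \<phi> v \<noteq> 0 \<longrightarrow>
     (\<exists>\<phi>'. is_hom C \<phi>' \<and> (\<forall>a\<in>A. \<phi>' a = \<phi> a) \<and> \<phi>' w \<noteq> 0)" using v by blast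
qed

lemma homs_extend_finite:
  assumes "finite X" and A: "is_subring A"
  shows "\<exists>B. is_subring B \<and> A \<subseteq> B \<and> X \<subseteq> B \<and> homs_extend A B"
  using assms(1)
proof induction
  case empty
  show ?case using A homs_extend_refl by blast
next
  case (insert x X)
  then obtain B where B: "is_subring B" "A \<subseteq> B" "X \<subseteq> B" "homs_extend A B" by blast
  note s = is_subring_adjoin[OF B(1), of x]
  have "homs_extend A (adjoin B x)"
    using homs_extend_trans[OF B(4) homs_extend_adjoin[OF B(1)] B(2)] .
  moreover have "A \<subseteq> adjoin B x" "insert x X \<subseteq> adjoin B x" using s B by auto
  ultimately show ?case using s(1) by blast
qed

section \<open>Points as homomorphisms, and generic preimages\<close>

lemma is_hom_mpoly_eval:
  assumes "is_hom UNIV \<phi>" "\<And>c. \<phi> (Const c) = c"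
  shows "\<phi> p = peval p (\<lambda>v. \<phi> (Var v))"
proof (induction p)
qed (use assms in \<open>auto simp: is_hom_def\<close>)

text \<open>The algebra homomorphism taking \<open>Var c\<close> to \<open>f c\<close>; its kernel
  consists of the algebraic relations between the \<open>f c\<close>.\<close>

lift_definition subst :: "('c \<Rightarrow> 'v mpoly) \<Rightarrow> 'c mpoly \<Rightarrow> 'v mpoly"
  is "\<lambda>f p h. p (\<lambda>c. f c h)"
proof -
  fix f :: "'c \<Rightarrow> ('v \<Rightarrow> complex) \<Rightarrow> complex" and p :: "('c \<Rightarrow> complex) \<Rightarrow> complex"
  assume f: "\<And>c. polyfun (f c)" and p: "polyfun p"
  from p show "polyfun (\<lambda>h. p (\<lambda>c. f c h))"
    by induction (auto intro: polyfun.intros f)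
qed

lemma peval_subst [simp]: "peval (subst f p) h = peval p (\<lambda>c. peval (f c) h)"
  by transfer simp

text \<open>A point of the target outside the zero set of \<open>v\<close> is a homomorphism on the subring generated by
  the \<open>f c\<close>; extending it to all of the polynomial ring yields a preimage.\<close>

theorem generic_preimage:
  fixes f :: "'c \<Rightarrow> 'v mpoly"
  assumes indep: "\<And>p. subst f p = 0 \<Longrightarrow> p = 0"
    and fin: "finite V" "\<And>v. v \<notin> V \<Longrightarrow> Var v \<in> range f"
    and \<rho>: "\<rho> \<noteq> 0"
  obtains P where "P \<noteq> 0"
    "\<And>y. peval P y \<noteq> 0 \<Longrightarrow> \<exists>\<xi>. (\<forall>c. peval (f c) \<xi> = y c) \<and> peval \<rho> \<xi> \<noteq> 0"
proof -
  have hom: "subst f (p - q) = subst f p - subst f q" "subst f (p + q) = subst f p + subst f q"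
    "subst f (p * q) = subst f p * subst f q" "subst f 1 = 1" "subst f (Var c) = f c"
    "subst f (Const a) = Const a" for p q c a
    by (auto simp: mpoly_eq_iff)
  define A where "A = range (subst f)"
  have A: "is_subring A"
    unfolding is_subring_def A_def by (auto simp flip: hom(1,3)) (metis hom(4) rangeI)
  have inj: "p = q" if "subst f p = subst f q" for p q
    using indep[of "p - q"] that by (simp add: hom)
  obtain B where B: "is_subring B" "A \<subseteq> B" "Var ` V \<subseteq> B" "homs_extend A B"
    using homs_extend_finite[OF finite_imageI[OF fin(1)] A] by blast
  have CA: "Const a \<in> A" and fA: "f c \<in> A" for a c unfolding A_def by (metis hom(5,6) rangeI)+
  \<comment> \<open>Every variable is some \<open>f c\<close> or one of the finitely many adjoined
    ones, so \<open>B\<close> exhausts the ring.\<close>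
  have "p \<in> B" for p
  proof (induction p)
    case (Const c)
    show ?case using CA B by blast
  next
    case (Var v)
    show ?case
    proof (cases "v \<in> V")
      case False
      then obtain c where "Var v = f c" using fin(2) by blast
      then show ?thesis using fA[of c] B(2) by auto
    qed (use B(3) in blast)
  qed (use is_subringD[OF B(1)] in auto)
  then have BU: "B = UNIV" by auto
  obtain v where v: "v \<in> A" "v \<noteq> 0" and v': "\<And>\<phi>. is_hom A \<phi> \<Longrightarrow> \<phi> v \<noteq> 0 \<Longrightarrow>
       \<exists>\<phi>'. is_hom UNIV \<phi>' \<and> (\<forall>a\<in>A. \<phi>' a = \<phi> a) \<and> \<phi>' \<rho> \<noteq> 0"
    using B(4) \<rho> unfolding BU homs_extend_def by (metis Diff_iff UNIV_I singletonI singletonD)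
  obtain P where P: "v = subst f P" using v by (auto simp: A_def)
  show thesis
  proof (rule that)
    show "P \<noteq> 0" using v P by (auto simp: mpoly_eq_iff)
    fix y assume y: "peval P y \<noteq> 0"
    \<comment> \<open>Evaluation at \<open>y\<close>, transported to \<open>A\<close>; independence
      makes the preimage under \<open>subst f\<close> unique.\<close>
    define \<phi> where "\<phi> g = peval (inv_into UNIV (subst f) g) y" for g
    have \<phi>: "\<phi> (subst f p) = peval p y" for p
      unfolding \<phi>_def using inj by (simp add: inv_f_f inj_def)
    have "is_hom A \<phi>"
      unfolding is_hom_def A_def using \<phi>[of 1] by (auto simp: hom(4) \<phi> simp flip: hom(2,3))
    moreover have "\<phi> v \<noteq> 0" using y by (simp add: P \<phi>)
    ultimately obtain \<phi>' where \<phi>': "is_hom UNIV \<phi>'" "\<forall>a\<in>A. \<phi>' a = \<phi> a" "\<phi>' \<rho> \<noteq> 0"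
      using v' by blast
    \<comment> \<open>Constants lie in \<open>A\<close> and stay fixed, so the extension is
      evaluation at a point.\<close>
    have "\<phi>' (Const c) = c" for c
      using bspec[OF \<phi>'(2) CA, of c] \<phi>[of "Const c"] by (simp add: hom)
    then have ev: "\<phi>' p = peval p (\<lambda>v. \<phi>' (Var v))" for p
      using is_hom_mpoly_eval \<phi>'(1) by blast
    show "\<exists>\<xi>. (\<forall>c. peval (f c) \<xi> = y c) \<and> peval \<rho> \<xi> \<noteq> 0"
    proof (intro exI conjI allI)
      show "peval \<rho> (\<lambda>v. \<phi>' (Var v)) \<noteq> 0" using \<phi>'(3) by (simp flip: ev)
      show "peval (f c) (\<lambda>v. \<phi>' (Var v)) = y c" for c
        using bspec[OF \<phi>'(2) fA, of c] \<phi>[of "Var c"] by (simp add: hom flip: ev)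
    qed
  qed
qed

section \<open>Algebraic independence from an invertible linear part\<close>

lemma mpoly_along_curve:
  assumes "\<And>c. \<exists>r. \<forall>s. u s c = poly r s"
  shows "\<exists>r. \<forall>s. peval p (u s) = poly r s"
  using polyfun_along_curve[of "peval p" u] peval assms by auto

text \<open>The coefficients of \<open>q\<close> are the homogeneous parts of \<open>p\<close> at
  \<open>y\<close>, as polynomials in the direction \<open>w\<close>.\<close>

lemma expand_along_lines:
  "\<exists>q. \<forall>s w. peval p (\<lambda>c. y c + s * w c) = peval (poly q (Const s)) w"
proof (induction p)
  case (Const a)
  show ?case by (intro exI[of _ "[:Const a:]"]) simp
next
  case (Var c)
  show ?case by (intro exI[of _ "[:Const (y c), Var c:]"]) simp
next
  case (add p q)
  then obtain p' q' where "\<forall>s w. peval p (\<lambda>c. y c + s * w c) = peval (poly p' (Const s)) w"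
    "\<forall>s w. peval q (\<lambda>c. y c + s * w c) = peval (poly q' (Const s)) w" by blast
  then show ?case by (intro exI[of _ "p' + q'"]) simp
next
  case (mult p q)
  then obtain p' q' where "\<forall>s w. peval p (\<lambda>c. y c + s * w c) = peval (poly p' (Const s)) w"
    "\<forall>s w. peval q (\<lambda>c. y c + s * w c) = peval (poly q' (Const s)) w" by blast
  then show ?case by (intro exI[of _ "p' * q'"]) simp
qed

text \<open>The lowest homogeneous part of \<open>p\<close> at \<open>y\<close> does not vanish at some \<open>w\<close>, and it dominates
  \<open>p\<close> along any curve leaving \<open>y\<close> in the direction \<open>w\<close>.\<close>

lemma mpoly_eq_0_if_vanishes_along_curves:
  assumes curve: "\<And>w. \<exists>R. \<forall>s. peval p (\<lambda>c. y c + s * (w c + s * poly (R c) s)) = 0"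
  shows "p = 0"
proof (rule ccontr)
  assume "p \<noteq> 0"
  obtain q where q: "\<And>s w. peval p (\<lambda>c. y c + s * w c) = peval (poly q (Const s)) w"
    using expand_along_lines by blast
  have "q \<noteq> 0"
  proof
    assume "q = 0"
    then have "peval p h = 0" for h using q[of 1 "\<lambda>c. h c - y c"] by simp
    then show False using \<open>p \<noteq> 0\<close> by (simp add: mpoly_eq_iff)
  qed
  then obtain q' where q': "q = [:- 0, 1:] ^ (Polynomial.order 0 q) * q'" "\<not> [:- 0, 1:] dvd q'"
    using order_decomp by blast
  define n where "n = Polynomial.order 0 q"
  \<comment> \<open>\<open>poly q' 0\<close> is the lowest homogeneous part mentioned above.\<close>
  have "poly q' 0 \<noteq> 0" using q'(2) by (simp add: poly_eq_0_iff_dvd)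
  then obtain w where w: "peval (poly q' 0) w \<noteq> 0" by (auto simp: mpoly_eq_iff)
  obtain R where R: "\<And>s. peval p (\<lambda>c. y c + s * (w c + s * poly (R c) s)) = 0"
    using curve by blast
  \<comment> \<open>The curve is read as a step by \<open>s\<close> in the direction
    \<open>u s\<close>, which varies with \<open>s\<close> and equals \<open>w\<close> at
    \<open>s = 0\<close>.\<close>
  define u where "u s c = w c + s * poly (R c) s" for s c
  have u: "\<exists>r. \<forall>s. u s c = poly r s" for c
    by (rule exI[of _ "[:w c:] + [:0, 1:] * R c"]) (simp add: u_def)
  have pw: "peval (x ^ n) h = peval x h ^ n" for x h and n :: nat
    by (induction n) auto
  have "s ^ n * peval (poly q' (Const s)) (u s) = 0" for s
  proof -
    have "poly q (Const s) = Const s ^ n * poly q' (Const s)"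
      by (subst q'(1)) (simp add: n_def)
    then have "peval (poly q (Const s)) (u s) = s ^ n * peval (poly q' (Const s)) (u s)"
      by (simp add: pw)
    then show ?thesis using R[of s] q[of s "u s"] by (simp add: u_def)
  qed
  then have z: "peval (poly q' (Const s)) (u s) = 0" if "s \<noteq> 0" for s using that by auto
  have "\<exists>r. \<forall>s. peval (poly g (Const s)) (u s) = poly r s" for g
  proof (induction g)
    case 0
    show ?case by (intro exI[of _ 0]) simp
  next
    case (pCons a g)
    then obtain r1 where r1: "\<forall>s. peval (poly g (Const s)) (u s) = poly r1 s" by blast
    obtain r2 where r2: "\<forall>s. peval a (u s) = poly r2 s" using mpoly_along_curve u by metis
    show ?case using r1 r2 by (intro exI[of _ "r2 + [:0, 1:] * r1"]) simp
  qed
  then obtain r where r: "\<And>s. peval (poly q' (Const s)) (u s) = poly r s" by blast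
  \<comment> \<open>A polynomial in \<open>s\<close> that vanishes away from 0 vanishes at 0 too,
    where the direction is \<open>w\<close>.\<close>
  have "poly r s = 0" if "s \<in> UNIV - {0}" for s using z r that by auto
  moreover have "infinite (UNIV - {0 :: complex})" by (simp add: infinite_UNIV_char_0)
  ultimately have "r = 0" using poly_roots_finite[of r]
    by (metis (mono_tags, lifting) finite_subset mem_Collect_eq subsetI)
  then have "peval (poly q' (Const 0)) (u 0) = 0" using r[of 0] by simp
  moreover have "Const 0 = (0 :: 'a mpoly)" by (simp add: mpoly_eq_iff)
  ultimately show False using w by (simp add: u_def[abs_def])
qed

section \<open>Zero sets of polynomials are null sets\<close>

lemma borel_measurable_peval:
  assumes "sets \<mu> = sets borel"
  shows "(\<lambda>h. peval p (\<lambda>c. if c \<in> J then h c else a c)) \<in> borel_measurable (PiM J (\<lambda>_. \<mu>))"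
proof (induction p)
  case (Var c)
  have "(\<lambda>h. h c) \<in> borel_measurable (PiM J (\<lambda>_. \<mu>))" if "c \<in> J"
    using measurable_component_singleton[OF that, of "\<lambda>_. \<mu>"] measurable_cong_sets[OF refl assms] by blast
  then show ?case by (cases "c \<in> J") auto
qed auto

text \<open>Fubini, one coordinate at a time: for almost all values of the others, the polynomial in
  the new coordinate is nonzero, and its finitely many roots form a null set by absolute continuity.
  The point \<open>a\<close> supplies the coordinates outside \<open>I\<close>.\<close>

lemma AE_peval_nonzero:
  fixes P :: "'c mpoly" and \<mu> :: "complex measure"
  assumes \<mu>: "continuous_distr \<mu>" and I: "finite I" and a: "peval P a \<noteq> 0"
  shows "AE h in PiM I (\<lambda>_. \<mu>). peval P (\<lambda>c. if c \<in> I then h c else a c) \<noteq> 0"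
  using I
proof induction
  case empty
  then show ?case using a by simp
next
  case (insert i I)
  have sets: "sets \<mu> = sets borel" and ac: "absolutely_continuous lborel \<mu>" and "prob_space \<mu>"
    using \<mu> by (auto simp: continuous_distr_def)
  interpret prob_space \<mu> by fact
  interpret product_sigma_finite "\<lambda>_. \<mu>" by standard
  let ?M = "PiM (insert i I) (\<lambda>_. \<mu>)"
  define e where "e J h = peval P (\<lambda>c. if c \<in> J then h c else a c)" for J h
  define N where "N = {h \<in> space ?M. e (insert i I) h = 0}"
  have meas: "e (insert i I) \<in> borel_measurable ?M"
    unfolding e_def by (rule borel_measurable_peval[OF sets])
  then have N: "N \<in> sets ?M" unfolding N_def by measurable
  have inner: "(\<integral>\<^sup>+ y. indicator N (h(i := y)) \<partial>\<mu>) = (0 :: ennreal)" if "e I h \<noteq> 0" for h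
  proof -
    define u where "u y c = (if c \<in> insert i I then (h(i := y)) c else a c)" for y c
    have "\<exists>r. \<forall>y. u y c = poly r y" for c
    proof (cases "c = i")
      case True
      then show ?thesis by (intro exI[of _ "[:0, 1:]"]) (simp add: u_def)
    next
      case False
      then show ?thesis by (intro exI[of _ "[:u 0 c:]"]) (simp add: u_def)
    qed
    then obtain r where r: "\<And>y. peval P (u y) = poly r y" using mpoly_along_curve by metis
    \<comment> \<open>Setting the new coordinate to \<open>a i\<close> gives back the nonzero value
      from the induction hypothesis.\<close>
    have "u (a i) = (\<lambda>c. if c \<in> I then h c else a c)" using insert by (auto simp: u_def)
    then have "poly r (a i) \<noteq> 0" using that r[of "a i"] by (simp add: e_def)
    then have "r \<noteq> 0" by auto
    then have "finite {y. poly r y = 0}" by (rule poly_roots_finite)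
    then have null: "{y. poly r y = 0} \<in> null_sets \<mu>"
      using ac finite_imp_null_set_lborel by (auto simp: absolutely_continuous_def)
    have "(\<integral>\<^sup>+ y. indicator N (h(i := y)) \<partial>\<mu>) \<le> (\<integral>\<^sup>+ y. indicator {y. poly r y = 0} y \<partial>\<mu>)"
    proof (rule nn_integral_mono)
      fix y
      have "e (insert i I) (h(i := y)) = poly r y"
        unfolding r[symmetric] e_def by (rule arg_cong[of _ _ "peval P"]) (rule ext, simp only: u_def)
      then have "poly r y = 0" if "h(i := y) \<in> N"
        using that by (simp add: N_def)
      then show "indicator N (h(i := y)) \<le> (indicator {y. poly r y = 0} y :: ennreal)"
        by (auto simp: indicator_def)
    qed
    also have "\<dots> = 0" using null by (simp add: null_sets_def)
    finally show ?thesis by simp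
  qed
  have "emeasure ?M N = (\<integral>\<^sup>+ h. indicator N h \<partial>?M)" using N by simp
  also have "\<dots> = (\<integral>\<^sup>+ h. \<integral>\<^sup>+ y. indicator N (h(i := y)) \<partial>\<mu> \<partial>PiM I (\<lambda>_. \<mu>))"
    using N insert by (intro product_nn_integral_insert) auto
  also have "\<dots> = (\<integral>\<^sup>+ h. 0 \<partial>PiM I (\<lambda>_. \<mu>))"
    using insert.IH by (intro nn_integral_cong_AE) (auto simp: inner simp flip: e_def)
  finally have "N \<in> null_sets ?M" using N by (simp add: null_sets_def)
  then show ?case by (rule AE_I') (auto simp: N_def e_def)
qed

section \<open>Hall's theorem and orientations of complete bipartite graphs\<close>

text \<open>Induction on the size of \<open>A\<close>: a nonempty proper subset without spare
  neighbours is matched first; if there is none, one element is matched arbitrarily.\<close>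

theorem hall:
  assumes "finite A" "\<And>x. x \<in> A \<Longrightarrow> finite (N x)" "\<And>X. X \<subseteq> A \<Longrightarrow> card X \<le> card (\<Union>(N ` X))"
  shows "\<exists>f. inj_on f A \<and> (\<forall>x\<in>A. f x \<in> N x)"
  using assms
proof (induction "card A" arbitrary: A N rule: less_induct)
  case less
  note fin = less.prems(1,2) and hall = less.prems(3)
  consider "A = {}" | X where "X \<subset> A" "X \<noteq> {}" "card (\<Union>(N ` X)) \<le> card X"
    | "A \<noteq> {}" "\<And>X. X \<subset> A \<Longrightarrow> X \<noteq> {} \<Longrightarrow> card X < card (\<Union>(N ` X))"
    using not_le by blast
  then show ?case
  proof cases
    case 1
    then show ?thesis by simp
  next
    case (2 X)
    let ?U = "\<Union>(N ` X)"
    have X: "X \<subseteq> A" "finite X" using 2 fin finite_subset by auto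
    have "card X < card A" using 2 fin by (simp add: psubset_card_mono)
    then obtain f where f: "inj_on f X" "\<And>x. x \<in> X \<Longrightarrow> f x \<in> N x"
      using less.hyps[of X N] X fin hall by (metis (no_types, lifting) subset_iff subset_trans)
    have cA: "card (A - X) < card A"
      using 2 fin X by (metis card_Diff_subset card_gt_0_iff diff_less le_zero_eq
        card_mono not_gr_zero finite_subset subset_empty)
    have "card Y \<le> card (\<Union>((\<lambda>x. N x - ?U) ` Y))" if Y: "Y \<subseteq> A - X" for Y
    proof -
      have finY: "finite Y" using Y fin finite_subset by blast
      have fU: "finite ?U" "finite (\<Union>(N ` (X \<union> Y)))" using X Y finY fin by auto
      have "card X + card Y = card (X \<union> Y)" using X Y finY by (subst card_Un_disjoint) auto
      also have "\<dots> \<le> card (\<Union>(N ` (X \<union> Y)))" using X Y by (intro hall) auto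
      also have "\<dots> = card (\<Union>(N ` (X \<union> Y)) - ?U) + card ?U"
        using fU by (subst card_Diff_subset) (auto intro!: le_add_diff_inverse2[symmetric] card_mono)
      also have "\<Union>(N ` (X \<union> Y)) - ?U = \<Union>((\<lambda>x. N x - ?U) ` Y)" by auto
      finally show ?thesis using 2 by simp
    qed
    then obtain g where g: "inj_on g (A - X)" "\<And>x. x \<in> A - X \<Longrightarrow> g x \<in> N x - ?U"
      using less.hyps[OF cA, of "\<lambda>x. N x - ?U"] fin by auto
    define F where "F x = (if x \<in> X then f x else g x)" for x
    have "inj_on F A"
    proof (rule inj_onI)
      fix x y assume xy: "x \<in> A" "y \<in> A" "F x = F y"
      show "x = y"
      proof (cases "x \<in> X"; cases "y \<in> X")
        assume "x \<in> X" "y \<notin> X"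
        then show ?thesis using xy f(2)[of x] g(2)[of y] by (auto simp: F_def)
      next
        assume "x \<notin> X" "y \<in> X"
        then show ?thesis using xy f(2)[of y] g(2)[of x] by (auto simp: F_def)
      qed (use xy f(1) g(1) in \<open>auto simp: F_def inj_on_def\<close>)
    qed
    moreover have "F x \<in> N x" if "x \<in> A" for x using that f g by (auto simp: F_def)
    ultimately show ?thesis by blast
  next
    case 3
    then obtain x where x: "x \<in> A" by auto
    then have "N x \<noteq> {}" using hall[of "{x}"] by auto
    then obtain y where y: "y \<in> N x" by blast
    have cA: "card (A - {x}) < card A" using x fin by (intro psubset_card_mono) auto
    \<comment> \<open>Every nonempty proper subset has a neighbour to spare, so losing
      \<open>y\<close> does no harm.\<close>
    have "card Y \<le> card (\<Union>((\<lambda>z. N z - {y}) ` Y))" if Y: "Y \<subseteq> A - {x}" for Y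
    proof (cases "Y = {}")
      case False
      have "finite Y" using Y fin finite_subset by blast
      then have finU: "finite (\<Union>(N ` Y))" using Y fin by auto
      have "card Y < card (\<Union>(N ` Y))" using 3(2)[of Y] Y x False by auto
      also have "card (\<Union>(N ` Y)) \<le> Suc (card (\<Union>(N ` Y) - {y}))"
        using finU by (metis card_Suc_Diff1 card.infinite diff_le_self Diff_insert0 Diff_empty le_SucI order_refl)
      also have "\<Union>(N ` Y) - {y} = \<Union>((\<lambda>z. N z - {y}) ` Y)" by auto
      finally show ?thesis by simp
    qed simp
    then obtain g where g: "inj_on g (A - {x})" "\<And>z. z \<in> A - {x} \<Longrightarrow> g z \<in> N z - {y}"
      using less.hyps[OF cA, of "\<lambda>z. N z - {y}"] fin by auto
    have "inj_on (g(x := y)) A"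
    proof (rule inj_onI)
      fix u v assume "u \<in> A" "v \<in> A" "(g(x := y)) u = (g(x := y)) v"
      then show "u = v" using g(2)[of u] g(2)[of v] inj_onD[OF g(1), of u v] by (auto split: if_splits)
    qed
    then show ?thesis using g(2) y by (intro exI[of _ "g(x := y)"]) auto
  qed
qed

text \<open>Each pair takes a private token from one of its ends, where \<open>k\<close> holds
  \<open>p k\<close> tokens and \<open>l\<close> holds \<open>q l\<close>; \<open>left\<close> tells
  which end pays and \<open>slot\<close> which token is taken.\<close>

lemma bipartite_orientation:
  fixes p :: "'a \<Rightarrow> nat" and q :: "'b \<Rightarrow> nat"
  assumes fin: "finite A" "finite B"
    and le: "\<And>X Y. X \<subseteq> A \<Longrightarrow> Y \<subseteq> B \<Longrightarrow> card X * card Y \<le> sum p X + sum q Y"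
  obtains left slot where
    "\<And>k l. k \<in> A \<Longrightarrow> l \<in> B \<Longrightarrow> left k l \<Longrightarrow> slot k l < p k"
    "\<And>k l. k \<in> A \<Longrightarrow> l \<in> B \<Longrightarrow> \<not> left k l \<Longrightarrow> slot k l < q l"
    "\<And>k l l'. k \<in> A \<Longrightarrow> l \<in> B \<Longrightarrow> l' \<in> B \<Longrightarrow> left k l \<Longrightarrow> left k l' \<Longrightarrow> slot k l = slot k l' \<Longrightarrow> l = l'"
    "\<And>k k' l. k \<in> A \<Longrightarrow> k' \<in> A \<Longrightarrow> l \<in> B \<Longrightarrow> \<not> left k l \<Longrightarrow> \<not> left k' l \<Longrightarrow> slot k l = slot k' l \<Longrightarrow> k = k'"
proof -
  define N :: "'a \<times> 'b \<Rightarrow> ('a \<times> nat + 'b \<times> nat) set"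
    where "N e = Inl ` (Sigma {fst e} (\<lambda>k. {..<p k})) \<union> Inr ` (Sigma {snd e} (\<lambda>l. {..<q l}))" for e
  have "\<exists>f. inj_on f (A \<times> B) \<and> (\<forall>x\<in>A \<times> B. f x \<in> N x)"
  proof (rule hall)
    fix X assume X: "X \<subseteq> A \<times> B"
    have fX: "finite X" using X fin by (meson finite_SigmaI finite_subset)
    have U: "\<Union>(N ` X) = Inl ` (Sigma (fst ` X) (\<lambda>k. {..<p k})) \<union> Inr ` (Sigma (snd ` X) (\<lambda>l. {..<q l}))"
      unfolding N_def by auto
    \<comment> \<open>A set of pairs lies in the rectangle spanned by its projections, so it
      suffices to know Hall's condition on rectangles.\<close>
    have "card X \<le> card (fst ` X \<times> snd ` X)"
      using fX by (intro card_mono) (auto simp: image_iff rev_image_eqI, force+)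
    also have "\<dots> \<le> sum p (fst ` X) + sum q (snd ` X)"
      unfolding card_cartesian_product using X by (intro le) auto
    also have "\<dots> = card (\<Union>(N ` X))"
      unfolding U using fX by (subst card_Un_disjoint) (auto simp: card_image)
    finally show "card X \<le> card (\<Union>(N ` X))" .
  qed (use fin in \<open>auto simp: N_def\<close>)
  then obtain f where f: "inj_on f (A \<times> B)" "\<And>k l. k \<in> A \<Longrightarrow> l \<in> B \<Longrightarrow> f (k, l) \<in> N (k, l)" by auto
  define slot where "slot k l = (case f (k, l) of Inl z \<Rightarrow> snd z | Inr z \<Rightarrow> snd z)" for k l
  have fL: "f (k, l) = Inl (k, slot k l) \<and> slot k l < p k" if "k \<in> A" "l \<in> B" "isl (f (k, l))" for k l
    using f(2)[OF that(1,2)] that(3) by (auto simp: N_def slot_def)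
  have fR: "f (k, l) = Inr (l, slot k l) \<and> slot k l < q l" if "k \<in> A" "l \<in> B" "\<not> isl (f (k, l))" for k l
    using f(2)[OF that(1,2)] that(3) by (auto simp: N_def slot_def)
  show thesis
  proof (rule that[of "\<lambda>k l. isl (f (k, l))" slot])
    fix k k' l l'
    assume k: "k \<in> A"
    show "slot k l < p k" if "l \<in> B" "isl (f (k, l))" using fL k that by blast
    show "slot k l < q l" if "l \<in> B" "\<not> isl (f (k, l))" using fR k that by blast
    show "l = l'" if "l \<in> B" "l' \<in> B" "isl (f (k, l))" "isl (f (k, l'))" "slot k l = slot k l'"
      using fL[of k l] fL[of k l'] k that inj_onD[OF f(1), of "(k, l)" "(k, l')"] by auto
    show "k = k'" if "k' \<in> A" "l \<in> B" "\<not> isl (f (k, l))" "\<not> isl (f (k', l))" "slot k l = slot k' l"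
      using fR[of k l] fR[of k' l] k that inj_onD[OF f(1), of "(k, l)" "(k', l)"] by auto
  qed
qed

section \<open>From nonsingular square blocks to beamformers\<close>

lemma mat_inverse_of_det_nonzero:
  fixes A :: "complex mat"
  assumes A: "A \<in> carrier_mat n n" and "det A \<noteq> 0"
  obtains B where "B \<in> carrier_mat n n" "A * B = 1\<^sub>m n" "B * A = 1\<^sub>m n"
proof
  show "(1 / det A) \<cdot>\<^sub>m adj_mat A \<in> carrier_mat n n"
    using adj_mat(1)[OF A] by simp
  show "A * ((1 / det A) \<cdot>\<^sub>m adj_mat A) = 1\<^sub>m n" "(1 / det A) \<cdot>\<^sub>m adj_mat A * A = 1\<^sub>m n"
    using adj_mat[OF A] A assms(2)
    by (auto simp: mult_smult_distrib[OF A] mult_smult_assoc_mat intro!: eq_matI)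
qed

text \<open>Receivers are stored with conjugated entries so that their adjoints, which enter the
  equations, stay polynomial in the unknowns.\<close>

lemma mat_adjoint_cnj:
  "mat_adjoint (mat m n (\<lambda>(i, j). cnj (f j i))) = mat n m (\<lambda>(i, j). f i j)"
  unfolding mat_adjoint_def by (intro eq_matI) (auto simp: mat_of_rows_def conjugate_vec_def)

lemma mat_triple_product:
  fixes f g h :: "nat \<Rightarrow> nat \<Rightarrow> 'a::comm_semiring_0"
  shows "mat a m (\<lambda>(i, j). f i j) * mat m n (\<lambda>(i, j). g i j) * mat n b (\<lambda>(i, j). h i j) =
    mat a b (\<lambda>(i, j). \<Sum>x<m. \<Sum>y<n. f i x * g x y * h y j)"
proof (intro eq_matI)
  fix i j assume "i < dim_row (mat a b (\<lambda>(i, j). \<Sum>x<m. \<Sum>y<n. f i x * g x y * h y j))"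
    "j < dim_col (mat a b (\<lambda>(i, j). \<Sum>x<m. \<Sum>y<n. f i x * g x y * h y j))"
  then have ij: "i < a" "j < b" by auto
  have "(\<Sum>y<n. (\<Sum>x<m. f i x * g x y) * h y j) = (\<Sum>x<m. \<Sum>y<n. f i x * g x y * h y j)"
    by (subst sum.swap) (simp add: sum_distrib_right)
  then show "(mat a m (\<lambda>(i, j). f i j) * mat m n (\<lambda>(i, j). g i j) * mat n b (\<lambda>(i, j). h i j)) $$ (i, j) =
    mat a b (\<lambda>(i, j). \<Sum>x<m. \<Sum>y<n. f i x * g x y * h y j) $$ (i, j)"
    using ij by (simp add: scalar_prod_def atLeast0LessThan)
qed auto

lemma crank_one: "crank (1\<^sub>m n) = n"
proof -
  interpret vec_space "TYPE(complex)" n .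
  show ?thesis using det_rank_iff[of "1\<^sub>m n"] by (simp add: crank_def)
qed

lemma block_index_less: "k \<in> {1..K} \<Longrightarrow> a < d \<Longrightarrow> (k - 1) * d + a < K * (d :: nat)"
proof -
  assume "k \<in> {1..K}" "a < d"
  then have "(k - 1) * d + a < (k - 1) * d + d" "Suc (k - 1) * d \<le> K * d"
    by (auto intro!: mult_le_mono1)
  then show ?thesis by simp
qed

lemma block_index_eq_iff:
  assumes "k \<in> {1..K}" "i \<in> {1..K}" "a < d" "b < (d :: nat)"
  shows "(k - 1) * d + a = (i - 1) * d + b \<longleftrightarrow> k = i \<and> a = b"
proof
  assume e: "(k - 1) * d + a = (i - 1) * d + b"
  have "k - 1 = i - 1" using arg_cong[OF e, of "\<lambda>x. x div d"] assms by simp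
  moreover have "a = b" using arg_cong[OF e, of "\<lambda>x. x mod d"] assms by simp
  ultimately show "k = i \<and> a = b" using assms by auto
qed simp

text \<open>The rows of all products of a downlink receiver's adjoint with its channel, followed by
  rows of \<open>GB\<close>. Users count from 1, so row \<open>a\<close> of user \<open>k\<close>
  has index \<open>(k - 1) * da + a\<close>. Entries may be numbers or polynomials.\<close>

definition stacked_rows where
  "stacked_rows K da Na ua h r j =
     (if r < K * da then \<Sum>i<Na (Suc (r div da)). ua (Suc (r div da)) (r mod da) i * h (HA (Suc (r div da)) i j)
      else h (GB (r - K * da) j))"

definition stacked_cols where
  "stacked_cols L db Nb vb h i c =
     (if c < L * db then \<Sum>j<Nb (Suc (c div db)). h (HB (Suc (c div db)) i j) * vb (Suc (c div db)) j (c mod db)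
      else h (GB i (c - L * db)))"

lemma sum_lessThan_extend:
  fixes f :: "nat \<Rightarrow> 'a::comm_monoid_add"
  assumes "n \<le> m" "\<And>i. n \<le> i \<Longrightarrow> f i = 0"
  shows "sum f {..<m} = sum f {..<n}"
  using assms by (intro sum.mono_neutral_right) auto

text \<open>In either case one of the two zero-forcing systems is enlarged by the rows or columns of
  \<open>G\<^sub>\<beta>\<close> on which the other side's beamformers are supported.\<close>

lemma feasible_of_nonsingular_blocks:
  fixes ua vb :: "nat \<Rightarrow> nat \<Rightarrow> nat \<Rightarrow> complex"
  assumes st: "s = L * db \<and> t = 0 \<or> s = 0 \<and> t = K * da"
    and bnd: "K * da + s \<le> Ma" "L * db + t \<le> Mb"
    and align: "\<And>k l a b. k \<in> {1..K} \<Longrightarrow> l \<in> {1..L} \<Longrightarrow> a < da \<Longrightarrow> b < db \<Longrightarrow>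
       (\<Sum>i<Na k. \<Sum>j<Nb l. ua k a i * h (GA k l i j) * vb l j b) = 0"
    and detS: "det (mat (K * da + s) (K * da + s) (\<lambda>(r, j). stacked_rows K da Na ua h r j)) \<noteq> 0"
    and detT: "det (mat (L * db + t) (L * db + t) (\<lambda>(i, c). stacked_cols L db Nb vb h i c)) \<noteq> 0"
  shows "feasible K L Ma Mb Na Nb (\<lambda>_. da) (\<lambda>_. db) h"
proof -
  define n m where "n = K * da + s" and "m = L * db + t"
  let ?R = "stacked_rows K da Na ua h" and ?C = "stacked_cols L db Nb vb h"
  obtain S' where S': "S' \<in> carrier_mat n n" "mat n n (\<lambda>(r, j). ?R r j) * S' = 1\<^sub>m n"
    using mat_inverse_of_det_nonzero[OF _ detS] unfolding n_def by (metis mat_carrier)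
  obtain T' where T': "T' \<in> carrier_mat m m" "T' * mat m m (\<lambda>(i, c). ?C i c) = 1\<^sub>m m"
    using mat_inverse_of_det_nonzero[OF _ detT] unfolding m_def by (metis mat_carrier)
  \<comment> \<open>Precoders are columns of one inverse and receivers rows of the other, padded
    with zeros on the antennas outside the square block.\<close>
  define va where "va k j a = (if j < n then S' $$ (j, (k - 1) * da + a) else 0)" for k j a
  define ub where "ub l b i = (if i < m then T' $$ ((l - 1) * db + b, i) else 0)" for l b i
  have R: "(\<Sum>j<Ma. ?R r j * va k j a) = (if r = (k - 1) * da + a then 1 else 0)"
    if "r < n" "k \<in> {1..K}" "a < da" for r k a
  proof -
    have c: "(k - 1) * da + a < n" using block_index_less[OF that(2,3)] by (simp add: n_def)
    have "(\<Sum>j<Ma. ?R r j * va k j a) = (\<Sum>j<n. ?R r j * va k j a)"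
      using bnd by (intro sum_lessThan_extend) (auto simp: n_def va_def)
    also have "\<dots> = (mat n n (\<lambda>(r, j). ?R r j) * S') $$ (r, (k - 1) * da + a)"
      using S'(1) that(1) c by (auto simp: scalar_prod_def atLeast0LessThan va_def intro!: sum.cong)
    finally show ?thesis using that(1) c S'(2) by simp
  qed
  have C: "(\<Sum>i<Mb. ub l b i * ?C i c) = (if c = (l - 1) * db + b then 1 else 0)"
    if "c < m" "l \<in> {1..L}" "b < db" for c l b
  proof -
    have r: "(l - 1) * db + b < m" using block_index_less[OF that(2,3)] by (simp add: m_def)
    have "(\<Sum>i<Mb. ub l b i * ?C i c) = (\<Sum>i<m. ub l b i * ?C i c)"
      using bnd by (intro sum_lessThan_extend) (auto simp: m_def ub_def)
    also have "\<dots> = (T' * mat m m (\<lambda>(i, c). ?C i c)) $$ ((l - 1) * db + b, c)"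
      using T'(1) that(1) r by (auto simp: scalar_prod_def atLeast0LessThan ub_def intro!: sum.cong)
    finally show ?thesis using that(1) r T'(2) by auto
  qed
  have HA: "(\<Sum>x<Na k. \<Sum>y<Ma. ua k a x * h (HA k x y) * va i y a') = (if k = i \<and> a = a' then 1 else 0)"
    if k: "k \<in> {1..K}" and i: "i \<in> {1..K}" and a: "a < da" "a' < da" for k i a a'
  proof -
    let ?r = "(k - 1) * da + a"
    have r: "?r < K * da" using block_index_less[OF k a(1)] .
    have "Suc (?r div da) = k" "?r mod da = a" using k a by auto
    then have "?R ?r y = (\<Sum>x<Na k. ua k a x * h (HA k x y))" for y
      using r by (simp add: stacked_rows_def)
    then have "(\<Sum>x<Na k. \<Sum>y<Ma. ua k a x * h (HA k x y) * va i y a') = (\<Sum>y<Ma. ?R ?r y * va i y a')"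
      by (subst sum.swap) (simp add: sum_distrib_right)
    also have "\<dots> = (if k = i \<and> a = a' then 1 else 0)"
      using R[of ?r i a'] r i a block_index_eq_iff[OF k i a] by (simp add: n_def)
    finally show ?thesis .
  qed
  have HB: "(\<Sum>x<Mb. \<Sum>y<Nb j. ub l b x * h (HB j x y) * vb j y b') = (if j = l \<and> b' = b then 1 else 0)"
    if l: "l \<in> {1..L}" and j: "j \<in> {1..L}" and b: "b < db" "b' < db" for l j b b'
  proof -
    let ?c = "(j - 1) * db + b'"
    have c: "?c < L * db" using block_index_less[OF j b(2)] .
    have "Suc (?c div db) = j" "?c mod db = b'" using j b by auto
    then have "?C x ?c = (\<Sum>y<Nb j. h (HB j x y) * vb j y b')" for x
      using c by (simp add: stacked_cols_def)
    then have "(\<Sum>x<Mb. \<Sum>y<Nb j. ub l b x * h (HB j x y) * vb j y b') = (\<Sum>x<Mb. ub l b x * ?C x ?c)"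
      by (simp add: sum_distrib_left mult.assoc)
    also have "\<dots> = (if j = l \<and> b' = b then 1 else 0)"
      using C[of ?c l b] c l b block_index_eq_iff[OF j l b(2,1)] by (simp add: m_def)
    finally show ?thesis .
  qed
  have GB: "(\<Sum>x<Mb. \<Sum>y<Ma. ub l b x * h (GB x y) * va k y a) = 0"
    if k: "k \<in> {1..K}" and l: "l \<in> {1..L}" and a: "a < da" and b: "b < db" for k l a b
  proof (cases "s = L * db \<and> t = 0")
    case True
    have "(\<Sum>y<Ma. ub l b x * h (GB x y) * va k y a) = 0" for x
    proof (cases "x < m")
      case x: True
      have "?R (K * da + x) y = h (GB x y)" for y by (simp add: stacked_rows_def)
      then have "(\<Sum>y<Ma. h (GB x y) * va k y a) = 0"
        using R[of "K * da + x" k a] x True k a block_index_less[OF k a] by (simp add: n_def m_def)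
      then show ?thesis by (simp add: mult.assoc flip: sum_distrib_left)
    qed (simp add: ub_def)
    then show ?thesis by simp
  next
    case False
    then have st': "s = 0" "t = K * da" using st by auto
    have "(\<Sum>x<Mb. ub l b x * h (GB x y) * va k y a) = 0" for y
    proof (cases "y < n")
      case y: True
      have "?C x (L * db + y) = h (GB x y)" for x by (simp add: stacked_cols_def)
      then have "(\<Sum>x<Mb. ub l b x * h (GB x y)) = 0"
        using C[of "L * db + y" l b] y st' l b block_index_less[OF l b] by (simp add: n_def m_def)
      then show ?thesis by (simp flip: sum_distrib_right)
    qed (simp add: va_def)
    then show ?thesis by (subst sum.swap) simp
  qed
  define Va where "Va k = mat Ma da (\<lambda>(j, a). va k j a)" for k
  define Ua where "Ua k = mat (Na k) da (\<lambda>(i, a). cnj (ua k a i))" for k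
  define Vb where "Vb l = mat (Nb l) db (\<lambda>(j, b). vb l j b)" for l
  define Ub where "Ub l = mat Mb db (\<lambda>(i, b). cnj (ub l b i))" for l
  have adj: "mat_adjoint (Ua k) = mat da (Na k) (\<lambda>(a, i). ua k a i)"
    "mat_adjoint (Ub l) = mat db Mb (\<lambda>(b, i). ub l b i)" for k l
    unfolding Ua_def Ub_def by (rule mat_adjoint_cnj)+
  note prods = adj Va_def Vb_def mat_triple_product
  show ?thesis
    unfolding feasible_def Let_def
  proof (rule exI[of _ Va], rule exI[of _ Ua], rule exI[of _ Vb], rule exI[of _ Ub], intro conjI ballI impI)
    fix k assume k: "k \<in> {1..K}"
    show "Va k \<in> carrier_mat Ma da" "Ua k \<in> carrier_mat (Na k) da"
      by (auto simp: Va_def Ua_def)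
    have "mat_adjoint (Ua k) * mat (Na k) Ma (\<lambda>(i, j). h (HA k i j)) * Va k = 1\<^sub>m da"
      unfolding prods by (intro eq_matI) (auto simp: HA[OF k k])
    then show "crank (mat_adjoint (Ua k) * mat (Na k) Ma (\<lambda>(i, j). h (HA k i j)) * Va k) = da"
      by (simp add: crank_one)
    show "mat_adjoint (Ua k) * mat (Na k) Ma (\<lambda>(i, j). h (HA k i j)) * Va i = 0\<^sub>m da da"
      if "i \<in> {1..K}" "i \<noteq> k" for i
      unfolding prods using that by (intro eq_matI) (auto simp: HA[OF k])
    fix l assume l: "l \<in> {1..L}"
    show "mat_adjoint (Ua k) * mat (Na k) (Nb l) (\<lambda>(i, j). h (GA k l i j)) * Vb l = 0\<^sub>m da db"
      unfolding prods by (intro eq_matI) (auto simp: align[OF k l])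
    show "mat_adjoint (Ub l) * mat Mb Ma (\<lambda>(i, j). h (GB i j)) * Va k = 0\<^sub>m db da"
      unfolding prods by (intro eq_matI) (auto simp: GB[OF k l])
  next
    fix l assume l: "l \<in> {1..L}"
    show "Vb l \<in> carrier_mat (Nb l) db" "Ub l \<in> carrier_mat Mb db"
      by (auto simp: Vb_def Ub_def)
    have "mat_adjoint (Ub l) * mat Mb (Nb l) (\<lambda>(i, j). h (HB l i j)) * Vb l = 1\<^sub>m db"
      unfolding prods by (intro eq_matI) (auto simp: HB[OF l l])
    then show "crank (mat_adjoint (Ub l) * mat Mb (Nb l) (\<lambda>(i, j). h (HB l i j)) * Vb l) = db"
      by (simp add: crank_one)
    show "mat_adjoint (Ub l) * mat Mb (Nb j) (\<lambda>(i, y). h (HB j i y)) * Vb j = 0\<^sub>m db db"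
      if "j \<in> {1..L}" "j \<noteq> l" for j
      unfolding prods using that by (intro eq_matI) (auto simp: HB[OF l])
  qed
qed

section \<open>The alignment equations\<close>

lemma sum_lessThan_plus:
  fixes g :: "nat \<Rightarrow> 'a::comm_monoid_add"
  shows "sum g {..<m + n} = sum g {..<m} + (\<Sum>i<n. g (m + i))"
  by (induction n) (auto simp: add.assoc)

lemma peval_det:
  "peval (det (mat n n (\<lambda>(i, j). e i j))) \<xi> = det (mat n n (\<lambda>(i, j). peval (e i j) \<xi>))"
proof -
  interpret comm_ring_hom "\<lambda>p. peval p \<xi>" by unfold_locales auto
  have "map_mat (\<lambda>p. peval p \<xi>) (mat n n (\<lambda>(i, j). e i j)) = mat n n (\<lambda>(i, j). peval (e i j) \<xi>)"
    by (intro eq_matI) auto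
  then show ?thesis by (metis hom_det)
qed

text \<open>With \<open>U\<^sub>k\<^sup>\<dagger> = [I, X\<^sub>k]\<close> and \<open>V\<^sub>l = [I; Y\<^sub>l]\<close>, where \<open>X\<^sub>k\<close> and \<open>Y\<^sub>l\<close> are split into blocks of
  size \<open>da \<times> db\<close>, each pair \<open>(k, l)\<close> owns the block number \<open>slot k l\<close> of \<open>X\<^sub>k\<close> or of \<open>Y\<^sub>l\<close>, according to
  \<open>left k l\<close>; all other blocks are zero. The alignment equations express the top left \<open>da \<times> db\<close> block
  (the corner) of each \<open>G\<^sub>\<alpha>\<^sub>k\<^sub>l\<close> through the remaining entries and the \<open>X\<^sub>k\<close>, \<open>Y\<^sub>l\<close>. The corner keys are
  therefore free, and they serve as names of the unknown entries of the owned blocks.\<close>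

locale alignment =
  fixes K L da db :: nat and p q :: "nat \<Rightarrow> nat"
    and left :: "nat \<Rightarrow> nat \<Rightarrow> bool" and slot :: "nat \<Rightarrow> nat \<Rightarrow> nat"
  assumes da: "da \<ge> 1" and db: "db \<ge> 1"
    and slot_left: "\<And>k l. k \<in> {1..K} \<Longrightarrow> l \<in> {1..L} \<Longrightarrow> left k l \<Longrightarrow> slot k l < p k"
    and slot_right: "\<And>k l. k \<in> {1..K} \<Longrightarrow> l \<in> {1..L} \<Longrightarrow> \<not> left k l \<Longrightarrow> slot k l < q l"
    and inj_left: "\<And>k l l'. k \<in> {1..K} \<Longrightarrow> l \<in> {1..L} \<Longrightarrow> l' \<in> {1..L} \<Longrightarrow> left k l \<Longrightarrow> left k l' \<Longrightarrow>
      slot k l = slot k l' \<Longrightarrow> l = l'"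
    and inj_right: "\<And>k k' l. k \<in> {1..K} \<Longrightarrow> k' \<in> {1..K} \<Longrightarrow> l \<in> {1..L} \<Longrightarrow> \<not> left k l \<Longrightarrow> \<not> left k' l \<Longrightarrow>
      slot k l = slot k' l \<Longrightarrow> k = k'"
begin

text \<open>\<open>i div db\<close> numbers the block and \<open>i mod db\<close> the column inside
  it; for \<open>k\<close> in range, \<open>inj_left\<close> leaves at most one nonzero
  summand.\<close>

definition X :: "nat \<Rightarrow> nat \<Rightarrow> nat \<Rightarrow> chan_key mpoly" where
  "X k a i = (\<Sum>l\<in>{1..L}. if left k l \<and> slot k l = i div db then Var (GA k l a (i mod db)) else 0)"

definition Y :: "nat \<Rightarrow> nat \<Rightarrow> nat \<Rightarrow> chan_key mpoly" where
  "Y l j b = (\<Sum>k\<in>{1..K}. if \<not> left k l \<and> slot k l = j div da then Var (GA k l (j mod da) b) else 0)"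

definition corner :: "chan_key set" where
  "corner = {GA k l a b | k l a b. k \<in> {1..K} \<and> l \<in> {1..L} \<and> a < da \<and> b < db}"

text \<open>Because of the identity blocks, a corner entry occurs in its alignment equation with
  coefficient one; its value here is the negated sum of the other terms.\<close>

fun par :: "chan_key \<Rightarrow> chan_key mpoly" where
  "par (GA k l a b) = (if GA k l a b \<in> corner then
     - ((\<Sum>i<p k * db. X k a i * Var (GA k l (da + i) b))
        + (\<Sum>j<q l * da. Var (GA k l a (db + j)) * Y l j b)
        + (\<Sum>i<p k * db. \<Sum>j<q l * da. X k a i * Var (GA k l (da + i) (db + j)) * Y l j b))
     else Var (GA k l a b))"
| "par c = Var c"

definition UA :: "nat \<Rightarrow> nat \<Rightarrow> nat \<Rightarrow> chan_key mpoly" where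
  "UA k a i = (if i < da then (if i = a then 1 else 0) else X k a (i - da))"

definition VB :: "nat \<Rightarrow> nat \<Rightarrow> nat \<Rightarrow> chan_key mpoly" where
  "VB l j b = (if j < db then (if j = b then 1 else 0) else Y l (j - db) b)"

lemma finite_corner: "finite corner"
proof -
  have "corner \<subseteq> (\<lambda>(k, l, a, b). GA k l a b) ` ({1..K} \<times> {1..L} \<times> {..<da} \<times> {..<db})"
    unfolding corner_def by force
  then show ?thesis by (rule finite_subset) auto
qed

lemma corner_iff: "c \<in> corner \<longleftrightarrow> (\<exists>k l a b. c = GA k l a b \<and> k \<in> {1..K} \<and> l \<in> {1..L} \<and> a < da \<and> b < db)"
  unfolding corner_def by auto

lemma par_not_corner: "c \<notin> corner \<Longrightarrow> par c = Var c"
  by (cases c) auto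

lemma alignment_of_par:
  assumes h: "\<And>c. peval (par c) \<xi> = h c"
    and kl: "k \<in> {1..K}" "l \<in> {1..L}" and ab: "a < da" "b < db"
    and N: "Na k = da + p k * db" "Nb l = db + q l * da"
  shows "(\<Sum>i<Na k. \<Sum>j<Nb l. peval (UA k a i) \<xi> * h (GA k l i j) * peval (VB l j b) \<xi>) = 0"
proof -
  let ?x = "\<lambda>i. peval (X k a i) \<xi>" and ?y = "\<lambda>j. peval (Y l j b) \<xi>"
  have col: "(\<Sum>j<Nb l. g j * peval (VB l j b) \<xi>) = g b + (\<Sum>j<q l * da. g (db + j) * ?y j)" for g
    using ab unfolding N sum_lessThan_plus
    by (simp add: VB_def if_distrib[of "\<lambda>z. peval z \<xi>"]
        if_distrib[of "\<lambda>z. _ * z"] cong: if_cong)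
  have row: "(\<Sum>i<Na k. peval (UA k a i) \<xi> * g i) = g a + (\<Sum>i<p k * db. ?x i * g (da + i))" for g
    using ab unfolding N sum_lessThan_plus
    by (simp add: UA_def if_distrib[of "\<lambda>z. peval z \<xi>"]
        if_distrib[of "\<lambda>z. z * _"] cong: if_cong)
  \<comment> \<open>The other entries in the equation lie outside the corner, where the
    parametrisation is the identity.\<close>
  have nc: "h c = \<xi> c" if "c \<notin> corner" for c
    using h[of c] par_not_corner[OF that] by simp
  have c: "GA k l a b \<in> corner" using kl ab by (auto simp: corner_iff)
  have e: "h (GA k l a b) = - ((\<Sum>i<p k * db. ?x i * h (GA k l (da + i) b))
        + (\<Sum>j<q l * da. h (GA k l a (db + j)) * ?y j)
        + (\<Sum>i<p k * db. \<Sum>j<q l * da. ?x i * h (GA k l (da + i) (db + j)) * ?y j))"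
    using h[of "GA k l a b", symmetric] c by (simp add: nc corner_iff)
  have "(\<Sum>i<Na k. \<Sum>j<Nb l. peval (UA k a i) \<xi> * h (GA k l i j) * peval (VB l j b) \<xi>)
    = (\<Sum>i<Na k. peval (UA k a i) \<xi> * (\<Sum>j<Nb l. h (GA k l i j) * peval (VB l j b) \<xi>))"
    by (simp add: sum_distrib_left mult.assoc)
  also have "\<dots> = 0"
    unfolding row col e by (simp add: sum.distrib sum_distrib_left algebra_simps)
  finally show ?thesis .
qed

text \<open>Here the owned blocks vanish and each \<open>GA k l\<close> carries an identity block
  exactly where the alignment equation multiplies it by the block owned by the pair.\<close>

definition base :: "chan_key \<Rightarrow> complex" where
  "base c = (case c of GA k l i j \<Rightarrow>
     if (if left k l then i \<ge> da \<and> j < db \<and> i - da = slot k l * db + j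
         else i < da \<and> j \<ge> db \<and> j - db = slot k l * da + i) then 1 else 0 | _ \<Rightarrow> 0)"

text \<open>At \<open>base\<close> the linear part is diagonal, with -1 on the corner and 1
  elsewhere. The sign change in \<open>v\<close> makes the image curve leave \<open>base\<close> in
  the direction \<open>w\<close>.\<close>

lemma par_along_line:
  assumes v: "\<And>c. v c = (if c \<in> corner then - w c else w c)"
  shows "\<exists>R. \<forall>s. peval (par c) (\<lambda>c. base c + s * v c) = base c + s * (w c + s * poly R s)"
proof (cases "c \<in> corner")
  case False
  then show ?thesis by (intro exI[of _ 0]) (simp add: par_not_corner v)
next
  case True
  then obtain k l a b where c: "c = GA k l a b" and kl: "k \<in> {1..K}" "l \<in> {1..L}" and ab: "a < da" "b < db"
    by (auto simp: corner_iff)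
  define x where "x i = (\<Sum>l\<in>{1..L}. if left k l \<and> slot k l = i div db then v (GA k l a (i mod db)) else 0)" for i
  define y where "y j = (\<Sum>k\<in>{1..K}. if \<not> left k l \<and> slot k l = j div da then v (GA k l (j mod da) b) else 0)" for j
  have base0: "base (GA k l a b) = 0" if "a < da" "b < db" for k l a b
    using that by (simp add: base_def)
  have X: "peval (X k a i) (\<lambda>c. base c + s * v c) = s * x i" for i s
    unfolding X_def x_def peval_sum sum_distrib_left
    using ab db by (intro sum.cong refl) (simp add: base0)
  have Y: "peval (Y l j b) (\<lambda>c. base c + s * v c) = s * y j" for j s
    unfolding Y_def y_def peval_sum sum_distrib_left
    using ab da by (intro sum.cong refl) (simp add: base0)
  \<comment> \<open>A single entry of the identity block contributes, and it picks out the unknown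
    named \<open>c\<close>.\<close>
  have lin: "(\<Sum>i<p k * db. x i * base (GA k l (da + i) b)) + (\<Sum>j<q l * da. base (GA k l a (db + j)) * y j) = - w c"
  proof (cases "left k l")
    case left: True
    let ?i = "slot k l * db + b"
    have lt: "?i < p k * db"
    proof -
      have "?i < Suc (slot k l) * db" using ab by simp
      also have "\<dots> \<le> p k * db" using slot_left[OF kl left] by (intro mult_le_mono1) simp
      finally show ?thesis .
    qed
    have "(\<Sum>i<p k * db. x i * base (GA k l (da + i) b)) = (\<Sum>i<p k * db. if i = ?i then x i else 0)"
      using ab left by (intro sum.cong) (auto simp: base_def)
    also have "\<dots> = x ?i" using lt by simp
    also have "x ?i = (\<Sum>l'\<in>{1..L}. if l' = l then v (GA k l a b) else 0)"
      unfolding x_def using ab left inj_left[OF kl(1)] kl by (intro sum.cong) auto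
    also have "\<dots> = - w c" using kl True by (simp add: v c)
    finally show ?thesis using left by (simp add: base_def)
  next
    case right: False
    let ?j = "slot k l * da + a"
    have lt: "?j < q l * da"
    proof -
      have "?j < Suc (slot k l) * da" using ab by simp
      also have "\<dots> \<le> q l * da" using slot_right[OF kl right] by (intro mult_le_mono1) simp
      finally show ?thesis .
    qed
    have "(\<Sum>j<q l * da. base (GA k l a (db + j)) * y j) = (\<Sum>j<q l * da. if j = ?j then y j else 0)"
      using ab right by (intro sum.cong) (auto simp: base_def)
    also have "\<dots> = y ?j" using lt by simp
    also have "y ?j = (\<Sum>k'\<in>{1..K}. if k' = k then v (GA k l a b) else 0)"
      unfolding y_def using ab right inj_right[OF _ kl(1) kl(2)] kl by (intro sum.cong) auto
    also have "\<dots> = - w c" using kl True by (simp add: v c)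
    finally show ?thesis using right by (simp add: base_def)
  qed
  \<comment> \<open>Up to sign, \<open>r0\<close> and \<open>r1\<close> are the coefficients of the
    second and third powers of \<open>s\<close>.\<close>
  define r0 where "r0 = (\<Sum>i<p k * db. x i * v (GA k l (da + i) b)) + (\<Sum>j<q l * da. v (GA k l a (db + j)) * y j)
    + (\<Sum>i<p k * db. \<Sum>j<q l * da. x i * base (GA k l (da + i) (db + j)) * y j)"
  define r1 where "r1 = (\<Sum>i<p k * db. \<Sum>j<q l * da. x i * v (GA k l (da + i) (db + j)) * y j)"
  show ?thesis
  proof (intro exI[of _ "[:- r0, - r1:]"] allI)
    fix s
    have "peval (par c) (\<lambda>c. base c + s * v c) =
      - ((\<Sum>i<p k * db. s * x i * (base (GA k l (da + i) b) + s * v (GA k l (da + i) b)))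
        + (\<Sum>j<q l * da. (base (GA k l a (db + j)) + s * v (GA k l a (db + j))) * (s * y j))
        + (\<Sum>i<p k * db. \<Sum>j<q l * da. s * x i *
             (base (GA k l (da + i) (db + j)) + s * v (GA k l (da + i) (db + j))) * (s * y j)))"
      using True unfolding c by (simp add: X Y)
    also have "\<dots> = - (s * ((\<Sum>i<p k * db. x i * base (GA k l (da + i) b))
        + (\<Sum>j<q l * da. base (GA k l a (db + j)) * y j)) + s * s * r0 + s * s * s * r1)"
      unfolding r0_def r1_def by (simp add: sum.distrib sum_distrib_left algebra_simps)
    finally show "peval (par c) (\<lambda>c. base c + s * v c) = base c + s * (w c + s * poly [:- r0, - r1:] s)"
      unfolding lin using base0[OF ab, of k l] by (simp add: c algebra_simps)
  qed
qed

text \<open>A relation between the components vanishes along the images of lines through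
  \<open>base\<close>, and these leave \<open>base\<close> in every direction.\<close>

lemma par_independent:
  assumes "subst par g = 0"
  shows "g = 0"
proof (rule mpoly_eq_0_if_vanishes_along_curves)
  fix w :: "chan_key \<Rightarrow> complex"
  define v where "v c = (if c \<in> corner then - w c else w c)" for c
  obtain R where R: "\<And>c s. peval (par c) (\<lambda>c. base c + s * v c) = base c + s * (w c + s * poly (R c) s)"
    using par_along_line[of v w] v_def by metis
  have "peval g (\<lambda>c. base c + s * (w c + s * poly (R c) s)) = 0" for s
    using arg_cong[OF assms, of "\<lambda>g. peval g (\<lambda>c. base c + s * v c)"] by (simp add: R)
  then show "\<exists>R. \<forall>s. peval g (\<lambda>c. base c + s * (w c + s * poly (R c) s)) = 0" by blast
qed

lemma blocks_generically_nonsingular: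
  assumes st: "s = L * db \<and> t = 0 \<or> s = 0 \<and> t = K * da"
    and N: "\<And>k. k \<in> {1..K} \<Longrightarrow> da \<le> Na k" "\<And>l. l \<in> {1..L} \<Longrightarrow> db \<le> Nb l"
  shows "det (mat (K * da + s) (K * da + s) (\<lambda>(r, j). stacked_rows K da Na UA Var r j)) *
    det (mat (L * db + t) (L * db + t) (\<lambda>(i, c). stacked_cols L db Nb VB Var i c)) \<noteq> 0"
proof -
  \<comment> \<open>A parameter point at which both matrices are identities: zero \<open>GA\<close>
    entries kill \<open>X\<close> and \<open>Y\<close>, and the ones in \<open>GB\<close> complete
    whichever matrix was enlarged.\<close>
  define \<xi> where "\<xi> c = (case c of GA _ _ _ _ \<Rightarrow> 0
    | HA k i j \<Rightarrow> if i < da \<and> j = (k - 1) * da + i then 1 else 0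
    | HB l i j \<Rightarrow> if j < db \<and> i = (l - 1) * db + j then 1 else 0
    | GB i j \<Rightarrow> if t = 0 \<and> j = K * da + i \<or> t \<noteq> 0 \<and> i = L * db + j then 1 else (0::complex))" for c
  have XY: "peval (X k a i) \<xi> = 0" "peval (Y l j b) \<xi> = 0" for k a i l j b
    unfolding X_def Y_def peval_sum by (auto intro!: sum.neutral simp: \<xi>_def)
  have S: "peval (stacked_rows K da Na UA Var r j) \<xi> = (if r = j then 1 else 0)"
    if r: "r < K * da + s" for r j
  proof (cases "r < K * da")
    case True
    let ?k = "Suc (r div da)" and ?a = "r mod da"
    have "r div da < K" using True by (simp add: less_mult_imp_div_less)
    then have k: "?k \<in> {1..K}" by simp
    have a: "?a < da" using da by simp
    have "peval (stacked_rows K da Na UA Var r j) \<xi> = (\<Sum>i<Na ?k. peval (UA ?k ?a i) \<xi> * \<xi> (HA ?k i j))"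
      using True by (simp add: stacked_rows_def)
    also have "\<dots> = (\<Sum>i<Na ?k. if i = ?a then \<xi> (HA ?k i j) else 0)"
      using a by (intro sum.cong) (auto simp: UA_def XY)
    also have "\<dots> = \<xi> (HA ?k ?a j)" using N(1)[OF k] a by simp
    also have "\<dots> = (if r = j then 1 else 0)" using a by (auto simp: \<xi>_def)
    finally show ?thesis .
  next
    case False
    then have "t = 0" using r st by auto
    then show ?thesis using False by (auto simp: stacked_rows_def \<xi>_def)
  qed
  have T: "peval (stacked_cols L db Nb VB Var i c) \<xi> = (if i = c then 1 else 0)"
    if c: "c < L * db + t" for i c
  proof (cases "c < L * db")
    case True
    let ?l = "Suc (c div db)" and ?b = "c mod db"
    have "c div db < L" using True by (simp add: less_mult_imp_div_less)
    then have l: "?l \<in> {1..L}" by simp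
    have b: "?b < db" using db by simp
    have "peval (stacked_cols L db Nb VB Var i c) \<xi> = (\<Sum>j<Nb ?l. \<xi> (HB ?l i j) * peval (VB ?l j ?b) \<xi>)"
      using True by (simp add: stacked_cols_def)
    also have "\<dots> = (\<Sum>j<Nb ?l. if j = ?b then \<xi> (HB ?l i j) else 0)"
      using b by (intro sum.cong) (auto simp: VB_def XY)
    also have "\<dots> = \<xi> (HB ?l i ?b)" using N(2)[OF l] b by simp
    also have "\<dots> = (if i = c then 1 else 0)" using b by (auto simp: \<xi>_def)
    finally show ?thesis .
  next
    case False
    then have "t \<noteq> 0" using c by auto
    then show ?thesis using False by (auto simp: stacked_cols_def \<xi>_def)
  qed
  have "peval (det (mat (K * da + s) (K * da + s) (\<lambda>(r, j). stacked_rows K da Na UA Var r j))) \<xi> = 1"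
    unfolding peval_det by (subst det_one[of "K * da + s", symmetric], rule arg_cong[of _ _ det])
      (intro eq_matI, auto simp: S)
  moreover have "peval (det (mat (L * db + t) (L * db + t) (\<lambda>(i, c). stacked_cols L db Nb VB Var i c))) \<xi> = 1"
    unfolding peval_det by (subst det_one[of "L * db + t", symmetric], rule arg_cong[of _ _ det])
      (intro eq_matI, auto simp: T)
  ultimately have "peval (det (mat (K * da + s) (K * da + s) (\<lambda>(r, j). stacked_rows K da Na UA Var r j)) *
    det (mat (L * db + t) (L * db + t) (\<lambda>(i, c). stacked_cols L db Nb VB Var i c))) \<xi> = 1" by simp
  then show ?thesis by (metis peval_simps(1) zero_neq_one)
qed

lemma generically_feasible:
  assumes st: "s = L * db \<and> t = 0 \<or> s = 0 \<and> t = K * da"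
    and bnd: "K * da + s \<le> Ma" "L * db + t \<le> Mb"
    and N: "\<And>k. k \<in> {1..K} \<Longrightarrow> Na k = da + p k * db" "\<And>l. l \<in> {1..L} \<Longrightarrow> Nb l = db + q l * da"
  obtains P where "P \<noteq> 0" "\<And>h. peval P h \<noteq> 0 \<Longrightarrow> feasible K L Ma Mb Na Nb (\<lambda>_. da) (\<lambda>_. db) h"
proof -
  let ?S = "det (mat (K * da + s) (K * da + s) (\<lambda>(r, j). stacked_rows K da Na UA Var r j))"
  let ?T = "det (mat (L * db + t) (L * db + t) (\<lambda>(i, c). stacked_cols L db Nb VB Var i c))"
  have "?S * ?T \<noteq> 0"
    by (rule blocks_generically_nonsingular[OF st]) (simp_all add: N)
  moreover have "Var c \<in> range par" if "c \<notin> corner" for c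
    using par_not_corner[OF that] by (metis rangeI)
  ultimately obtain P where P: "P \<noteq> 0"
    "\<And>h. peval P h \<noteq> 0 \<Longrightarrow> \<exists>\<xi>. (\<forall>c. peval (par c) \<xi> = h c) \<and> peval (?S * ?T) \<xi> \<noteq> 0"
    using generic_preimage[of par corner "?S * ?T"] par_independent finite_corner by metis
  have "feasible K L Ma Mb Na Nb (\<lambda>_. da) (\<lambda>_. db) h" if nz: "peval P h \<noteq> 0" for h
  proof -
    obtain \<xi> where \<xi>: "\<And>c. peval (par c) \<xi> = h c" and ST: "peval (?S * ?T) \<xi> \<noteq> 0" using P(2)[OF nz] by blast
    have nc: "h c = \<xi> c" if "c \<notin> corner" for c
      using \<xi>[of c] par_not_corner[OF that] by simp
    \<comment> \<open>Outside the receivers and precoders, the stacked matrices use only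
      \<open>HA\<close>, \<open>HB\<close> and \<open>GB\<close>, which are never corner
      keys.\<close>
    have "peval (stacked_rows K da Na UA Var r j) \<xi> = stacked_rows K da Na (\<lambda>k a i. peval (UA k a i) \<xi>) h r j" for r j
      by (simp add: stacked_rows_def nc corner_iff)
    moreover have "peval (stacked_cols L db Nb VB Var i c) \<xi> = stacked_cols L db Nb (\<lambda>l j b. peval (VB l j b) \<xi>) h i c" for i c
      by (simp add: stacked_cols_def nc corner_iff)
    ultimately have "det (mat (K * da + s) (K * da + s) (\<lambda>(r, j). stacked_rows K da Na (\<lambda>k a i. peval (UA k a i) \<xi>) h r j)) \<noteq> 0"
      "det (mat (L * db + t) (L * db + t) (\<lambda>(i, c). stacked_cols L db Nb (\<lambda>l j b. peval (VB l j b) \<xi>) h i c)) \<noteq> 0"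
      using ST by (simp_all add: peval_det)
    then show ?thesis
      using st bnd N alignment_of_par[OF \<xi>] by (intro feasible_of_nonsingular_blocks) auto
  qed
  then show thesis using that P(1) by blast
qed

end

section \<open>Almost sure feasibility\<close>

lemma finite_chan_index: "finite (chan_index K L Ma Mb Na Nb)"
proof -
  have "{HA k i j | k i j. k \<in> {1..K} \<and> i < Na k \<and> j < Ma} \<subseteq>
      (\<lambda>(k, i, j). HA k i j) ` (SIGMA k:{1..K}. {..<Na k} \<times> {..<Ma})"
    "{GA k l i j | k l i j. k \<in> {1..K} \<and> l \<in> {1..L} \<and> i < Na k \<and> j < Nb l} \<subseteq>
      (\<lambda>(k, l, i, j). GA k l i j) ` (SIGMA k:{1..K}. SIGMA l:{1..L}. {..<Na k} \<times> {..<Nb l})"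
    "{HB l i j | l i j. l \<in> {1..L} \<and> i < Mb \<and> j < Nb l} \<subseteq>
      (\<lambda>(l, i, j). HB l i j) ` (SIGMA l:{1..L}. {..<Mb} \<times> {..<Nb l})"
    "{GB i j | i j. i < Mb \<and> j < Ma} \<subseteq> (\<lambda>(i, j). GB i j) ` ({..<Mb} \<times> {..<Ma})"
    by (force simp: image_iff)+
  from this[THEN finite_subset] show ?thesis unfolding chan_index_def by auto
qed

text \<open>The product measure knows only the coordinates in \<open>chan_index\<close>; the
  polynomial criterion needs all of them, so the others are filled in arbitrarily.\<close>

lemma feasible_cong:
  assumes h: "\<And>c. c \<in> chan_index K L Ma Mb Na Nb \<Longrightarrow> h c = h' c"
  shows "feasible K L Ma Mb Na Nb da db h \<longleftrightarrow> feasible K L Ma Mb Na Nb da db h'"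
proof -
  have 1: "mat (Na k) Ma (\<lambda>(i, j). h (HA k i j)) = mat (Na k) Ma (\<lambda>(i, j). h' (HA k i j))" if "k \<in> {1..K}" for k
    using that by (intro eq_matI) (auto intro!: h simp: chan_index_def)
  have 2: "mat (Na k) (Nb l) (\<lambda>(i, j). h (GA k l i j)) = mat (Na k) (Nb l) (\<lambda>(i, j). h' (GA k l i j))"
    if "k \<in> {1..K}" "l \<in> {1..L}" for k l
    using that by (intro eq_matI) (auto intro!: h simp: chan_index_def)
  have 3: "mat Mb (Nb l) (\<lambda>(i, j). h (HB l i j)) = mat Mb (Nb l) (\<lambda>(i, j). h' (HB l i j))" if "l \<in> {1..L}" for l
    using that by (intro eq_matI) (auto intro!: h simp: chan_index_def)
  have 4: "mat Mb Ma (\<lambda>(i, j). h (GB i j)) = mat Mb Ma (\<lambda>(i, j). h' (GB i j))"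
    by (intro eq_matI) (auto intro!: h simp: chan_index_def)
  show ?thesis
    unfolding feasible_def Let_def
    by (intro ex_cong1 conj_cong ball_cong imp_cong refl) (simp_all only: 1 2 3 4)
qed

theorem theorem3:
  fixes K L Ma Mb :: nat and Na Nb :: "nat \<Rightarrow> nat" and da db :: nat
    and \<mu> :: "complex measure"
  assumes "K \<ge> 1" and "L \<ge> 1" and "da \<ge> 1" and "db \<ge> 1"
    and "K * da \<le> Ma" and "L * db \<le> Mb" and "K * da + L * db \<le> max Ma Mb"
    and "\<forall>k\<in>{1..K}. (int (Na k) - int da) mod int db = 0"
    and "\<forall>l\<in>{1..L}. (int (Nb l) - int db) mod int da = 0"
    and "\<forall>Ia Ib. Ia \<subseteq> {1..K} \<and> Ib \<subseteq> {1..L} \<longrightarrow>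
           int (card Ia * card Ib * da * db)
             \<le> (\<Sum>k\<in>Ia. int da * (int (Na k) - int da)) + (\<Sum>l\<in>Ib. int db * (int (Nb l) - int db))"
    and "continuous_distr \<mu>"
  shows "AE h in PiM (chan_index K L Ma Mb Na Nb) (\<lambda>_. \<mu>).
           feasible K L Ma Mb Na Nb (\<lambda>_. da) (\<lambda>_. db) h"
proof -
  note da = assms(3) and db = assms(4) and hall_cond = assms(10)
  define p where "p k = (Na k - da) div db" for k
  define q where "q l = (Nb l - db) div da" for l
  have Na: "Na k = da + p k * db" if k: "k \<in> {1..K}" for k
  proof -
    \<comment> \<open>A singleton in the dimension count gives \<open>da \<le> Na k\<close>, so the
      natural subtraction in \<open>p\<close> is exact.\<close>
    have "0 \<le> int da * (int (Na k) - int da)" using hall_cond[rule_format, of "{k}" "{}"] k by simp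
    then have ge: "da \<le> Na k" using da by (simp add: zero_le_mult_iff)
    have "int db dvd int (Na k) - int da" using assms(8) k by (simp add: dvd_eq_mod_eq_0)
    then have "db dvd Na k - da" using ge by (simp flip: of_nat_diff)
    then show ?thesis using ge by (simp add: p_def)
  qed
  have Nb: "Nb l = db + q l * da" if l: "l \<in> {1..L}" for l
  proof -
    have "0 \<le> int db * (int (Nb l) - int db)" using hall_cond[rule_format, of "{}" "{l}"] l by simp
    then have ge: "db \<le> Nb l" using db by (simp add: zero_le_mult_iff)
    have "int da dvd int (Nb l) - int db" using assms(9) l by (simp add: dvd_eq_mod_eq_0)
    then have "da dvd Nb l - db" using ge by (simp flip: of_nat_diff)
    then show ?thesis using ge by (simp add: q_def)
  qed
  have orient: "card A * card B \<le> sum p A + sum q B" if "A \<subseteq> {1..K}" "B \<subseteq> {1..L}" for A B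
  proof -
    have "int (card A * card B * da * db) \<le>
        (\<Sum>k\<in>A. int da * (int (Na k) - int da)) + (\<Sum>l\<in>B. int db * (int (Nb l) - int db))"
      using hall_cond that by blast
    also have "(\<Sum>k\<in>A. int da * (int (Na k) - int da)) = (\<Sum>k\<in>A. int (p k) * int (da * db))"
      using that Na by (intro sum.cong) auto
    also have "(\<Sum>l\<in>B. int db * (int (Nb l) - int db)) = (\<Sum>l\<in>B. int (q l) * int (da * db))"
      using that Nb by (intro sum.cong) auto
    finally have "int (card A * card B * (da * db)) \<le> int ((sum p A + sum q B) * (da * db))"
      by (simp only: of_nat_mult of_nat_add of_nat_sum distrib_right sum_distrib_right mult.assoc)
    then have "card A * card B * (da * db) \<le> (sum p A + sum q B) * (da * db)"
      by (simp only: of_nat_le_iff)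
    then show ?thesis using da db by simp
  qed
  have "\<exists>left slot. alignment K L da db p q left slot"
  proof (rule bipartite_orientation[of "{1..K}" "{1..L}" p q])
    fix left slot
    assume "\<And>k l. k \<in> {1..K} \<Longrightarrow> l \<in> {1..L} \<Longrightarrow> left k l \<Longrightarrow> slot k l < p k"
      "\<And>k l. k \<in> {1..K} \<Longrightarrow> l \<in> {1..L} \<Longrightarrow> \<not> left k l \<Longrightarrow> slot k l < q l"
      "\<And>k l l'. k \<in> {1..K} \<Longrightarrow> l \<in> {1..L} \<Longrightarrow> l' \<in> {1..L} \<Longrightarrow> left k l \<Longrightarrow> left k l' \<Longrightarrow>
        slot k l = slot k l' \<Longrightarrow> l = l'"
      "\<And>k k' l. k \<in> {1..K} \<Longrightarrow> k' \<in> {1..K} \<Longrightarrow> l \<in> {1..L} \<Longrightarrow> \<not> left k l \<Longrightarrow> \<not> left k' l \<Longrightarrow>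
        slot k l = slot k' l \<Longrightarrow> k = k'"
    from alignment.intro[OF da db this] show ?thesis by (intro exI)
  qed (use orient in auto)
  then obtain left slot where "alignment K L da db p q left slot" by blast
  then interpret alignment K L da db p q left slot .
  obtain P where P: "P \<noteq> 0" "\<And>h. peval P h \<noteq> 0 \<Longrightarrow> feasible K L Ma Mb Na Nb (\<lambda>_. da) (\<lambda>_. db) h"
  \<comment> \<open>The base station with more antennas receives the enlarged zero-forcing system,
    since all streams together fit there.\<close>
  proof (cases "Mb \<le> Ma")
    case True
    show thesis
      by (rule generically_feasible[of "L * db" 0 Ma Mb Na Nb]) (use True assms Na Nb that in auto)
  next
    case False
    show thesis
      by (rule generically_feasible[of 0 "K * da" Ma Mb Na Nb]) (use False assms Na Nb that in auto)
  qed
  obtain a where a: "peval P a \<noteq> 0" using P(1) by (auto simp: mpoly_eq_iff)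
  let ?I = "chan_index K L Ma Mb Na Nb"
  show ?thesis
    using AE_peval_nonzero[OF assms(11) finite_chan_index a]
  proof (rule AE_mp, intro AE_I2 impI)
    fix h assume "peval P (\<lambda>c. if c \<in> ?I then h c else a c) \<noteq> 0"
    from P(2)[OF this] show "feasible K L Ma Mb Na Nb (\<lambda>_. da) (\<lambda>_. db) h"
      by (subst (asm) feasible_cong[where h' = h]) auto
  qed
qed

end
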